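(* Let $\mathcal{D}$ be a label-invariant property of distributions over $\{0,1\}^n$ that is testable in the standard distribution-testing model using $s(n,\epsilon)=\Omega(1/\epsilon)$ samples. Let $\Pi\subseteq\{0,1\}^n$ be a property of strings that is testable with query complexity $q_T(n,\epsilon)$ and self-correctable up to distance $\delta(n)$ with $q_C(n)$ queries; that is, there is an oracle machine $C$ making at most $q_C(n)$ queries such that for every $x\in\{0,1\}^n$ and $i\in[n]$: (1) if $x\in\Pi$ then $\Pr[C^x(i)=x_i]\ge 2/3$; (2) if $x$ is $\delta(n)$-close (in relative Hamming distance) to $x'\in\Pi$ then $\Pr[C^x(i)\in\{x'_i,\bot\}]\ge 2/3$, where $\bot$ is a special failure symbol. Suppose every distribution in $\mathcal{D}$ is supported by a set of size at most $|\Pi|$, and let $\mathcal{D}_\Pi$ be the set of all distributions in $\mathcal{D}$ whose support is a subset of $\Pi$. Suppose also that $q_T(n,\epsilon)\ge 2\cdot q_T(n,2\epsilon)$ for all $\epsilon\in[O(1/n),\Omega(1)]$. Then $\mathcal{D}_\Pi$ is testable in the DoHO model with query complexity $$q(n,\epsilon)=\widetilde{O}(s(n,\epsilon'/2))\cdot\frac{q_T(n,\delta(n))+q_C(n)}{\delta(n)}$$ and sample complexity $s(n,\epsilon'/2)$, where $\epsilon'=\min(\epsilon,\delta(n))$.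
   Context: For $x,y\in\{0,1\}^n$ let $\Delta_H(x,y)=\frac1n|\{i:x_i\neq y_i\}|$; $x$ is $\delta$-close to $x'$ if $\Delta_H(x,x')\le\delta$, and $\epsilon$-far from a set $\Pi$ of strings if $\Delta_H(x,z)>\epsilon$ for all $z\in\Pi$. A tester for a string property $\Pi$ with query complexity $q_T$ is an oracle machine that on input $n,\epsilon$ and oracle access to $x\in\{0,1\}^n$ makes at most $q_T(n,\epsilon)$ queries, accepts with probability at least $2/3$ if $x\in\Pi$, and rejects with probability at least $2/3$ if $x$ is $\epsilon$-far from $\Pi$. The distance between distributions $P,Q$ over $\{0,1\}^n$ is $\min\sum_{x,y}w_{x,y}\Delta_H(x,y)$ over nonnegative $w_{x,y}$ with $\sum_y w_{x,y}=P(x)$, $\sum_x w_{x,y}=Q(y)$; $\epsilon$-far from a set means distance greater than $\epsilon$ from each member. A tester in the DoHO model for a set $\mathcal{E}$ of distributions over $\{0,1\}^n$ gets $n,\epsilon$ and oracle access to independent samples of an unknown distribution $P$, may query individual bits of samples, and must accept with probability at least $2/3$ if $P\in\mathcal{E}$ and reject with probability at least $2/3$ if $P$ is $\epsilon$-far from $\mathcal{E}$; its query complexity is the total number of bit queries. In the standard model the samples are given in full and farness is in total variation distance. $\mathcal{D}$ is label-invariant if for every bijection $\pi:\{0,1\}^n\to\{0,1\}^n$, $P\in\mathcal{D}$ iff $\pi(P)\in\mathcal{D}$.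
   Formalization: The sample complexity is proved as O(s(n,ε'/2)) rather than exactly s(n,ε'/2), which fails when the constant in s=Ω(1/ε) is small; and δ(n) is assumed to lie in (0,1), since δ(n)=1 fails for a singleton Π with zero queries. *)

theory Defs
  imports "HOL-Probability.Probability" "HOL-Library.Landau_Symbols"
begin

section \<open>Strings and distributions over strings\<close>

definition strings :: "nat \<Rightarrow> bool list set" where
  "strings n = {x. length x = n}"

definition hdist :: "nat \<Rightarrow> bool list \<Rightarrow> bool list \<Rightarrow> real" where
  "hdist n x y = real (card {i. i < n \<and> x ! i \<noteq> y ! i}) / real n"

definition close_to :: "nat \<Rightarrow> real \<Rightarrow> bool list \<Rightarrow> bool list \<Rightarrow> bool" where
  "close_to n \<delta> x x' \<longleftrightarrow> hdist n x x' \<le> \<delta>"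

definition far_from :: "nat \<Rightarrow> real \<Rightarrow> bool list \<Rightarrow> bool list set \<Rightarrow> bool" where
  "far_from n \<epsilon> x A \<longleftrightarrow> (\<forall>z\<in>A. hdist n x z > \<epsilon>)"

definition dists :: "nat \<Rightarrow> bool list pmf set" where
  "dists n = {P. set_pmf P \<subseteq> strings n}"

definition tv_dist :: "nat \<Rightarrow> bool list pmf \<Rightarrow> bool list pmf \<Rightarrow> real" where
  "tv_dist n P Q = (\<Sum>x\<in>strings n. \<bar>pmf P x - pmf Q x\<bar>) / 2"

definition transport_plans ::
  "nat \<Rightarrow> bool list pmf \<Rightarrow> bool list pmf \<Rightarrow> (bool list \<Rightarrow> bool list \<Rightarrow> real) set" where
  "transport_plans n P Q = {w.
     (\<forall>x\<in>strings n. \<forall>y\<in>strings n. 0 \<le> w x y) \<and>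
     (\<forall>x\<in>strings n. (\<Sum>y\<in>strings n. w x y) = pmf P x) \<and>
     (\<forall>y\<in>strings n. (\<Sum>x\<in>strings n. w x y) = pmf Q y)}"

text \<open>For distributions over strings of length \<open>n\<close> the set of plans is nonempty and compact
  (as a set of matrices), so the infimum is the minimum of the linear program.\<close>

definition emd :: "nat \<Rightarrow> bool list pmf \<Rightarrow> bool list pmf \<Rightarrow> real" where
  "emd n P Q = (INF w\<in>transport_plans n P Q.
     \<Sum>x\<in>strings n. \<Sum>y\<in>strings n. w x y * hdist n x y)"

definition tv_far :: "nat \<Rightarrow> real \<Rightarrow> bool list pmf \<Rightarrow> bool list pmf set \<Rightarrow> bool" where
  "tv_far n \<epsilon> P E \<longleftrightarrow> (\<forall>Q\<in>E. tv_dist n P Q > \<epsilon>)"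

definition emd_far :: "nat \<Rightarrow> real \<Rightarrow> bool list pmf \<Rightarrow> bool list pmf set \<Rightarrow> bool" where
  "emd_far n \<epsilon> P E \<longleftrightarrow> (\<forall>Q\<in>E. emd n P Q > \<epsilon>)"

definition label_invariant :: "nat \<Rightarrow> bool list pmf set \<Rightarrow> bool" where
  "label_invariant n E \<longleftrightarrow>
     (\<forall>\<pi>. bij_betw \<pi> (strings n) (strings n) \<longrightarrow>
        (\<forall>P\<in>dists n. P \<in> E \<longleftrightarrow> map_pmf \<pi> P \<in> E))"

section \<open>Oracle machines\<close>

text \<open>A deterministic machine querying bits at positions of type \<open>'q\<close> is a decision tree.
  A randomized machine is a distribution over decision trees: all coins are tossed in advance.
  Machines may depend on \<open>n\<close> and \<open>\<epsilon>\<close> arbitrarily; only queries are counted.\<close>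

datatype (positions: 'q, outputs: 'a) dtree =
  Output 'a
| Query 'q "('q, 'a) dtree" "('q, 'a) dtree"

primrec run :: "('q, 'a) dtree \<Rightarrow> ('q \<Rightarrow> bool) \<Rightarrow> 'a" where
  "run (Output a) f = a"
| "run (Query q l r) f = (if f q then run r f else run l f)"

primrec depth :: "('q, 'a) dtree \<Rightarrow> nat" where
  "depth (Output a) = 0"
| "depth (Query q l r) = Suc (max (depth l) (depth r))"

type_synonym ('q, 'a) machine = "('q, 'a) dtree pmf"

definition query_bounded :: "('q, 'a) machine \<Rightarrow> 'q set \<Rightarrow> real \<Rightarrow> bool" where
  "query_bounded M I b \<longleftrightarrow> (\<forall>t\<in>set_pmf M. positions t \<subseteq> I \<and> real (depth t) \<le> b)"

definition machine_output :: "('q, 'a) machine \<Rightarrow> ('q \<Rightarrow> bool) \<Rightarrow> 'a pmf" where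
  "machine_output M f = map_pmf (\<lambda>t. run t f) M"

section \<open>Testers and self-correctors\<close>

text \<open>Testers output \<^const>\<open>True\<close> to accept and \<^const>\<open>False\<close> to reject.\<close>

definition params :: "(nat \<times> real) set" where
  "params = {(n, \<epsilon>). 1 \<le> n \<and> 0 < \<epsilon> \<and> \<epsilon> \<le> 1}"

definition string_testable :: "(nat \<Rightarrow> bool list set) \<Rightarrow> (nat \<Rightarrow> real \<Rightarrow> real) \<Rightarrow> bool" where
  "string_testable L q \<longleftrightarrow>
     (\<exists>T :: nat \<Rightarrow> real \<Rightarrow> (nat, bool) machine. \<forall>(n, \<epsilon>)\<in>params.
        query_bounded (T n \<epsilon>) {..<n} (q n \<epsilon>) \<and>
        (\<forall>x\<in>strings n.
           (x \<in> L n \<longrightarrow> pmf (machine_output (T n \<epsilon>) (\<lambda>i. x ! i)) True \<ge> 2/3) \<and>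
           (far_from n \<epsilon> x (L n) \<longrightarrow> pmf (machine_output (T n \<epsilon>) (\<lambda>i. x ! i)) False \<ge> 2/3)))"

text \<open>The failure symbol is \<^const>\<open>None\<close>; positions are numbered from \<open>0\<close>.\<close>

definition self_correctable ::
  "(nat \<Rightarrow> bool list set) \<Rightarrow> (nat \<Rightarrow> real) \<Rightarrow> (nat \<Rightarrow> real) \<Rightarrow> bool" where
  "self_correctable L \<delta> q \<longleftrightarrow>
     (\<exists>C :: nat \<Rightarrow> nat \<Rightarrow> (nat, bool option) machine. \<forall>n\<ge>1. \<forall>i<n.
        query_bounded (C n i) {..<n} (q n) \<and>
        (\<forall>x\<in>strings n.
           (x \<in> L n \<longrightarrow> pmf (machine_output (C n i) (\<lambda>j. x ! j)) (Some (x ! i)) \<ge> 2/3) \<and>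
           (\<forall>x'\<in>L n. close_to n (\<delta> n) x x' \<longrightarrow>
              measure_pmf.prob (machine_output (C n i) (\<lambda>j. x ! j)) {Some (x' ! i), None} \<ge> 2/3)))"

definition standard_testable ::
  "(nat \<Rightarrow> bool list pmf set) \<Rightarrow> (nat \<Rightarrow> real \<Rightarrow> nat) \<Rightarrow> bool" where
  "standard_testable E s \<longleftrightarrow>
     (\<exists>T :: nat \<Rightarrow> real \<Rightarrow> bool list list \<Rightarrow> bool pmf. \<forall>(n, \<epsilon>)\<in>params. \<forall>P\<in>dists n.
        (P \<in> E n \<longrightarrow> pmf (bind_pmf (replicate_pmf (s n \<epsilon>) P) (T n \<epsilon>)) True \<ge> 2/3) \<and>
        (tv_far n \<epsilon> P (E n) \<longrightarrow> pmf (bind_pmf (replicate_pmf (s n \<epsilon>) P) (T n \<epsilon>)) False \<ge> 2/3))"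

text \<open>A machine in the DoHO model has oracle access to \<open>m\<close> samples: position \<open>(j, i)\<close> is
  bit \<open>i\<close> of sample \<open>j\<close>.\<close>

definition doho_output ::
  "(nat \<times> nat, bool) machine \<Rightarrow> nat \<Rightarrow> bool list pmf \<Rightarrow> bool pmf" where
  "doho_output M m P =
     bind_pmf (replicate_pmf m P) (\<lambda>xs. machine_output M (\<lambda>(j, i). xs ! j ! i))"

definition doho_testable ::
  "(nat \<Rightarrow> bool list pmf set) \<Rightarrow> (nat \<Rightarrow> real \<Rightarrow> nat) \<Rightarrow> (nat \<Rightarrow> real \<Rightarrow> real) \<Rightarrow> bool" where
  "doho_testable E m q \<longleftrightarrow>
     (\<exists>T :: nat \<Rightarrow> real \<Rightarrow> (nat \<times> nat, bool) machine. \<forall>(n, \<epsilon>)\<in>params.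
        query_bounded (T n \<epsilon>) ({..<m n \<epsilon>} \<times> {..<n}) (q n \<epsilon>) \<and>
        (\<forall>P\<in>dists n.
           (P \<in> E n \<longrightarrow> pmf (doho_output (T n \<epsilon>) (m n \<epsilon>) P) True \<ge> 2/3) \<and>
           (emd_far n \<epsilon> P (E n) \<longrightarrow> pmf (doho_output (T n \<epsilon>) (m n \<epsilon>) P) False \<ge> 2/3)))"

section \<open>Asymptotic notation\<close>

text \<open>\<open>O\<close>, \<open>\<Omega>\<close> and soft-\<open>O\<close> are uniform over all lengths and all proximity parameters, which is
  what the principal filter of \<^const>\<open>params\<close> expresses.  Soft-\<open>O\<close> of \<open>g\<close> means \<open>O(g \<cdot> log^k g)\<close>
  for some \<open>k\<close>; the shift by \<open>2\<close> keeps the logarithm away from \<open>0\<close>.\<close>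

definition soft_bigo :: "'a filter \<Rightarrow> ('a \<Rightarrow> real) \<Rightarrow> ('a \<Rightarrow> real) set" where
  "soft_bigo F g = (\<Union>k::nat. O[F](\<lambda>a. g a * ln (\<bar>g a\<bar> + 2) ^ k))"

end

theory Submission
  imports Defs
begin

text \<open>
  Each sample is tested for membership in \<open>\<Pi>\<close> at proximity \<open>\<delta>\<close>, and its value at one random position is
  compared with the self-corrected value.  Passing both on \<open>O(1 / \<epsilon>')\<close> samples means that \<open>P\<close> is close, in
  earth mover's distance, to the distribution \<open>\<kappa>(P)\<close> of the corrected samples, which lives on \<open>\<Pi>\<close>.

  A label-invariant tester may be averaged over all relabellings, after which its verdict depends only on
  which samples coincide.  Self-correctability forces distinct elements of \<open>\<Pi>\<close> to differ in more than a
  \<open>\<delta>\<close> fraction of the positions, so self-correcting every sample at the same \<open>O(log s / \<delta>)\<close> random positions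
  reveals the coincidences among the corrected samples, and the tester for \<open>\<D>\<close> can be run on \<open>\<kappa>(P)\<close>.
  If \<open>\<kappa>(P)\<close> is close to some \<open>R \<in> \<D>\<close> in total variation, then relabelling the support of \<open>R\<close> into \<open>\<Pi>\<close>
  (there is room, by the support bound) gives a member of \<open>\<D>\<^sub>\<Pi>\<close> that is no farther.
\<close>

section \<open>Probability of composed experiments\<close>

text \<open>Testing strings at proximity \<delta> keeps the price per sample independent of
  \<epsilon> up to logarithms, but leaves a gap: a sample may be \<delta>-close to \<Pi> and still
  farther than \<epsilon>' / 2 from its corrected word. The random position closes the gap, since it
  exposes a disagreement with probability equal to the Hamming distance, whose average is the cost
  of moving each x to its corrected word. Farness is therefore split evenly: \<epsilon>' / 2 for
  this cost and \<epsilon>' / 2 for the total variation between \<kappa>(P) and \<D>, which is why s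
  is evaluated at \<epsilon>' / 2. A failure symbol always means rejection. So failure counts as
  success in the soundness analysis, while completeness has to exclude it for all samples at once.
  In both cases a union bound over samples and fingerprint positions asks for O(log s) repetitions
  of the string tester and of the corrector. The distribution tester itself is first amplified to
  error 1/10, which leaves room for a simulation error of 1/10.\<close>

lemma prob_bind_pmf:
  "measure_pmf.prob (bind_pmf p f) B = (\<integral>x. measure_pmf.prob (f x) B \<partial>measure_pmf p)"
proof -
  \<comment> \<open>An event is treated as a Boolean random variable, so that
    \<open>pmf_bind\<close> applies.\<close>
  have *: "measure_pmf.prob q B = pmf (map_pmf (\<lambda>x. x \<in> B) q) True" for q
    by (simp add: pmf_map vimage_def)
  show ?thesis
    unfolding * map_bind_pmf pmf_bind ..
qed

lemma integrable_prob_pmf: "integrable (measure_pmf p) (\<lambda>x. measure_pmf.prob (f x) B)"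
  by (rule measure_pmf.integrable_const_bound[where B = 1]) auto

text \<open>Pointwise the inner probability is at least \<open>b\<close> minus the indicator of the
  complement of \<open>A\<close>: off \<open>A\<close> this is \<open>b - 1\<close>, nonpositive
  since \<open>b \<le> 1\<close>. Chaining the rule adds up failure probabilities, a sequential
  union bound.\<close>

lemma prob_bind_pmf_ge:
  assumes "measure_pmf.prob p A \<ge> 1 - a"
    and "\<And>x. x \<in> set_pmf p \<Longrightarrow> x \<in> A \<Longrightarrow> measure_pmf.prob (f x) B \<ge> b"
    and "b \<le> 1"
  shows "measure_pmf.prob (bind_pmf p f) B \<ge> b - a"
proof -
  have "b - a \<le> b - measure_pmf.prob p (- A)"
    using assms(1) measure_pmf.prob_compl[of A p] by (simp add: Compl_eq_Diff_UNIV)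
  also have "\<dots> = (\<integral>x. b - indicator (- A) x \<partial>measure_pmf p)"
    by (subst Bochner_Integration.integral_diff)
       (auto intro!: measure_pmf.integrable_const_bound[where B = 1])
  also have "\<dots> \<le> (\<integral>x. measure_pmf.prob (f x) B \<partial>measure_pmf p)"
  proof (rule integral_mono_AE)
    show "AE x in measure_pmf p. b - indicator (- A) x \<le> measure_pmf.prob (f x) B"
      using assms(2,3) by (auto simp: AE_measure_pmf_iff indicator_def intro: order_trans[of _ 0])
  qed (auto intro!: measure_pmf.integrable_const_bound[where B = 1]
         Bochner_Integration.integrable_diff integrable_prob_pmf)
  finally show ?thesis
    by (simp add: prob_bind_pmf)
qed

lemma prob_bind_pmf_mono:
  assumes "\<And>x. x \<in> set_pmf p \<Longrightarrow> measure_pmf.prob (g x) B - a \<le> measure_pmf.prob (f x) B"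
  shows "measure_pmf.prob (bind_pmf p g) B - a \<le> measure_pmf.prob (bind_pmf p f) B"
proof -
  have "measure_pmf.prob (bind_pmf p g) B - a =
      (\<integral>x. measure_pmf.prob (g x) B - a \<partial>measure_pmf p)"
    unfolding prob_bind_pmf
    by (subst Bochner_Integration.integral_diff) (auto intro: integrable_prob_pmf)
  also have "\<dots> \<le> (\<integral>x. measure_pmf.prob (f x) B \<partial>measure_pmf p)"
    by (rule integral_mono_AE)
       (auto simp: AE_measure_pmf_iff assms intro!: integrable_prob_pmf Bochner_Integration.integrable_diff)
  finally show ?thesis
    by (simp add: prob_bind_pmf)
qed

lemma prob_bind_pmf_le_split:
  assumes "\<And>x. x \<in> A \<Longrightarrow> measure_pmf.prob (f x) B \<le> u"
    and "\<And>x. x \<notin> A \<Longrightarrow> measure_pmf.prob (f x) B \<le> v"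
  shows "measure_pmf.prob (bind_pmf p f) B \<le> u * measure_pmf.prob p A + v * (1 - measure_pmf.prob p A)"
proof -
  have "measure_pmf.prob (bind_pmf p f) B \<le> (\<integral>x. v + (u - v) * indicator A x \<partial>measure_pmf p)"
    unfolding prob_bind_pmf
  proof (rule integral_mono)
    show "measure_pmf.prob (f x) B \<le> v + (u - v) * indicator A x" for x
      using assms by (auto simp: indicator_def)
  qed (auto intro!: integrable_prob_pmf Bochner_Integration.integrable_add integrable_mult_right
         measure_pmf.integrable_const_bound[where B = 1 and f = "indicator A"])
  also have "\<dots> = v + (u - v) * measure_pmf.prob p A"
    by (subst Bochner_Integration.integral_add)
       (auto intro!: measure_pmf.integrable_const_bound[where B = 1] integrable_mult_right)
  finally show ?thesis
    by (simp add: algebra_simps)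
qed

section \<open>Tail bounds for independent repetitions\<close>

lemma prob_replicate_pmf_subset_le:
  "measure_pmf.prob (replicate_pmf k p) {ys. set ys \<subseteq> A} \<le> measure_pmf.prob p A ^ k"
proof (induction k)
  case (Suc k)
  have *: "measure_pmf.prob (bind_pmf (replicate_pmf k p) (\<lambda>xs. return_pmf (x # xs))) {ys. set ys \<subseteq> A}
     = (if x \<in> A then measure_pmf.prob (replicate_pmf k p) {ys. set ys \<subseteq> A} else 0)" for x
    by (simp add: map_pmf_def[symmetric] vimage_def)
  have "measure_pmf.prob (replicate_pmf (Suc k) p) {ys. set ys \<subseteq> A} \<le>
      measure_pmf.prob p A ^ k * measure_pmf.prob p A + 0 * (1 - measure_pmf.prob p A)"
    unfolding replicate_pmf.simps
    by (rule prob_bind_pmf_le_split) (simp_all add: * Suc.IH)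
  then show ?case
    by (simp add: mult.commute)
qed simp

text \<open>Chernoff's argument with base 2: each draw contributes the factor 2 - prob S \<le> 4/3
  to the mean of 2^(number of bad entries), and Markov's inequality divides by 2^r. The induction
  performs both at once, a bad entry lowering \<open>r\<close> by one.\<close>

lemma prob_replicate_pmf_many_bad:
  assumes "measure_pmf.prob p S \<ge> 2/3"
  shows "measure_pmf.prob (replicate_pmf k p) {ys. r \<le> length (filter (\<lambda>y. y \<notin> S) ys)}
    \<le> (4/3) ^ k / 2 ^ r"
proof (induction k arbitrary: r)
  case 0
  then show ?case by (cases r) auto
next
  case (Suc k)
  let ?W = "\<lambda>ys. length (filter (\<lambda>y. y \<notin> S) ys)"
  show ?case
  proof (cases r)
    case 0
    have "1 \<le> ((4/3) ^ Suc k :: real)"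
      by (rule one_le_power) simp
    then show ?thesis
      using 0 by (intro order_trans[OF measure_pmf.prob_le_1]) simp
  next
    case r: (Suc r')
    have *: "measure_pmf.prob (bind_pmf (replicate_pmf k p) (\<lambda>xs. return_pmf (x # xs))) {ys. r \<le> ?W ys}
      = measure_pmf.prob (replicate_pmf k p) {ys. (if x \<in> S then r else r') \<le> ?W ys}" for x
      by (simp add: map_pmf_def[symmetric] vimage_def r)
    have "measure_pmf.prob (replicate_pmf (Suc k) p) {ys. r \<le> ?W ys} \<le>
       (4/3) ^ k / 2 ^ r * measure_pmf.prob p S + (4/3) ^ k / 2 ^ r' * (1 - measure_pmf.prob p S)"
      unfolding replicate_pmf.simps
      by (rule prob_bind_pmf_le_split)
         (simp_all only: * if_True if_False Suc.IH)
    also have "\<dots> = (4/3) ^ k / 2 ^ r * (2 - measure_pmf.prob p S)"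
      by (simp add: r field_simps)
    also have "\<dots> \<le> (4/3) ^ k / 2 ^ r * (4/3)"
      using assms by (intro mult_left_mono) auto
    finally show ?thesis
      by (simp add: mult_ac)
  qed
qed

lemma prob_replicate_pmf_majority:
  assumes "measure_pmf.prob p S \<ge> 2/3"
  shows "measure_pmf.prob (replicate_pmf (2 * r) p) {ys. length (filter (\<lambda>y. y \<notin> S) ys) < r}
    \<ge> 1 - (8/9) ^ r"
proof -
  let ?B = "{ys. r \<le> length (filter (\<lambda>y. y \<notin> S) ys)}"
  have "measure_pmf.prob (replicate_pmf (2 * r) p) ?B \<le> (4/3) ^ (2 * r) / 2 ^ r"
    by (rule prob_replicate_pmf_many_bad[OF assms])
  \<comment> \<open>(4/3)^2 / 2 = 8/9, the decay rate of every majority vote below.\<close>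
  also have "\<dots> = (8/9) ^ r"
    by (simp add: power_mult power2_eq_square flip: power_divide)
  finally have "measure_pmf.prob (replicate_pmf (2 * r) p) (UNIV - ?B) \<ge> 1 - (8/9) ^ r"
    using measure_pmf.prob_compl[of ?B "replicate_pmf (2 * r) p"] by simp
  moreover have "UNIV - ?B = {ys. length (filter (\<lambda>y. y \<notin> S) ys) < r}"
    by auto
  ultimately show ?thesis by simp
qed

text \<open>Independent draws whose laws may differ: every sample and every fingerprint position has
  its own output law.\<close>

primrec seq_pmf :: "'a pmf list \<Rightarrow> 'a list pmf" where
  "seq_pmf [] = return_pmf []"
| "seq_pmf (p # ps) = bind_pmf p (\<lambda>y. map_pmf (Cons y) (seq_pmf ps))"

lemma seq_pmf_replicate: "seq_pmf (replicate k p) = replicate_pmf k p"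
  by (induction k) (simp_all add: map_pmf_def)

lemma prob_seq_pmf_ge:
  assumes "\<And>x. x \<in> set xs \<Longrightarrow> measure_pmf.prob (f x) (G x) \<ge> 1 - a"
  shows "measure_pmf.prob (seq_pmf (map f xs)) {ys. list_all2 (\<lambda>x y. y \<in> G x) xs ys}
    \<ge> 1 - real (length xs) * a"
  using assms
proof (induction xs)
  case (Cons x xs)
  let ?b = "1 - real (length xs) * a"
  have a: "0 \<le> a"
    using order_trans[OF Cons.prems[of x] measure_pmf.prob_le_1] by simp
  have "?b - a \<le> measure_pmf.prob (seq_pmf (map f (x # xs))) {ys. list_all2 (\<lambda>x y. y \<in> G x) (x # xs) ys}"
    unfolding seq_pmf.simps list.map
  proof (rule prob_bind_pmf_ge)
    show "measure_pmf.prob (f x) (G x) \<ge> 1 - a"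
      using Cons.prems by simp
    show "?b \<le> 1"
      using a by simp
    fix y assume "y \<in> G x"
    then show "?b \<le> measure_pmf.prob (map_pmf ((#) y) (seq_pmf (map f xs)))
        {ys. list_all2 (\<lambda>x y. y \<in> G x) (x # xs) ys}"
      using Cons.IH Cons.prems by (simp add: vimage_def)
  qed
  then show ?case
    by (simp add: algebra_simps)
qed simp

text \<open>Processing independent samples separately yields independent, identically distributed
  outcomes. \<open>tester_sound_distance\<close> needs this to bound the chance that no outcome is a
  failure by a power.\<close>

lemma bind_replicate_pmf_seq_pmf:
  "bind_pmf (replicate_pmf k p) (\<lambda>xs. seq_pmf (map f xs)) = replicate_pmf k (bind_pmf p f)"
proof (induction k)
  case (Suc k)
  have "bind_pmf (replicate_pmf (Suc k) p) (\<lambda>xs. seq_pmf (map f xs)) =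
     bind_pmf p (\<lambda>x. bind_pmf (replicate_pmf k p) (\<lambda>xs. bind_pmf (f x) (\<lambda>y. map_pmf (Cons y) (seq_pmf (map f xs)))))"
    by (simp add: bind_assoc_pmf bind_return_pmf)
  also have "\<dots> = bind_pmf p (\<lambda>x. bind_pmf (f x) (\<lambda>y. map_pmf (Cons y)
      (bind_pmf (replicate_pmf k p) (\<lambda>xs. seq_pmf (map f xs)))))"
    by (subst bind_commute_pmf) (simp add: map_bind_pmf)
  also have "\<dots> = replicate_pmf (Suc k) (bind_pmf p f)"
    by (simp add: Suc.IH bind_assoc_pmf map_pmf_def)
  finally show ?case .
qed (simp add: bind_return_pmf)

lemma map_replicate_pmf:
  "map_pmf (map f) (replicate_pmf k p) = replicate_pmf k (map_pmf f p)"
proof (induction k)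
  case (Suc k)
  have "map_pmf (map f) (replicate_pmf (Suc k) p) =
      bind_pmf p (\<lambda>x. map_pmf (Cons (f x)) (map_pmf (map f) (replicate_pmf k p)))"
    by (simp add: map_bind_pmf map_pmf_comp flip: map_pmf_def)
  also have "\<dots> = replicate_pmf (Suc k) (map_pmf f p)"
    by (simp only: Suc.IH) (simp add: bind_map_pmf flip: map_pmf_def)
  finally show ?case .
qed simp

section \<open>Composition of query machines\<close>

text \<open>A machine tosses its coins in advance, so a randomized continuation is drawn at every
  leaf beforehand. The draws at different leaves are independent, which is harmless because a run
  reaches only one leaf.\<close>

primrec tree_bind :: "('q, 'a) dtree \<Rightarrow> ('a \<Rightarrow> ('q, 'b) machine) \<Rightarrow> ('q, 'b) machine" where
  "tree_bind (Output a) g = g a"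
| "tree_bind (Query q l r) g =
     bind_pmf (tree_bind l g) (\<lambda>l'. map_pmf (Query q l') (tree_bind r g))"

definition mbind :: "('q, 'a) machine \<Rightarrow> ('a \<Rightarrow> ('q, 'b) machine) \<Rightarrow> ('q, 'b) machine" where
  "mbind M g = bind_pmf M (\<lambda>t. tree_bind t g)"

definition mlift :: "'a pmf \<Rightarrow> ('q, 'a) machine" where
  "mlift p = map_pmf Output p"

definition mquery :: "'q \<Rightarrow> ('q, bool) machine" where
  "mquery q = return_pmf (Query q (Output False) (Output True))"

definition mreindex :: "('p \<Rightarrow> 'q) \<Rightarrow> ('p, 'a) machine \<Rightarrow> ('q, 'a) machine" where
  "mreindex h M = map_pmf (map_dtree h id) M"

primrec mseq :: "('q, 'a) machine list \<Rightarrow> ('q, 'a list) machine" where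
  "mseq [] = mlift (return_pmf [])"
| "mseq (M # Ms) = mbind M (\<lambda>y. mbind (mseq Ms) (\<lambda>ys. mlift (return_pmf (y # ys))))"

lemma machine_output_tree_bind:
  "machine_output (tree_bind t g) f = machine_output (g (run t f)) f"
proof (induction t)
  case (Query q l r)
  have "machine_output (tree_bind (Query q l r) g) f =
     bind_pmf (tree_bind l g) (\<lambda>l'. bind_pmf (tree_bind r g)
        (\<lambda>r'. return_pmf (if f q then run r' f else run l' f)))"
    by (simp add: machine_output_def map_bind_pmf bind_map_pmf map_pmf_comp)
       (simp add: map_pmf_def)
  also have "\<dots> = (if f q then machine_output (tree_bind r g) f else machine_output (tree_bind l g) f)"
    by (simp add: machine_output_def map_pmf_def)
  finally show ?case
    using Query by simp
qed simp

lemma machine_output_mbind: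
  "machine_output (mbind M g) f = bind_pmf (machine_output M f) (\<lambda>a. machine_output (g a) f)"
  by (simp add: mbind_def machine_output_tree_bind bind_map_pmf machine_output_def[of M]
      machine_output_def[of "bind_pmf _ _"] map_bind_pmf flip: machine_output_def[of "tree_bind _ _"])

lemma machine_output_mlift: "machine_output (mlift p) f = p"
  by (simp add: machine_output_def mlift_def map_pmf_comp)

lemma machine_output_mquery: "machine_output (mquery q) f = return_pmf (f q)"
  by (simp add: machine_output_def mquery_def)

lemma run_map_dtree: "run (map_dtree h id t) f = run t (\<lambda>q. f (h q))"
  by (induction t) auto

lemma depth_map_dtree: "depth (map_dtree h g t) = depth t"
  by (induction t) auto

lemma machine_output_mreindex: "machine_output (mreindex h M) f = machine_output M (\<lambda>q. f (h q))"
  by (simp add: machine_output_def mreindex_def map_pmf_comp run_map_dtree)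

lemma machine_output_mseq:
  "machine_output (mseq Ms) f = seq_pmf (map (\<lambda>M. machine_output M f) Ms)"
  by (induction Ms) (simp_all add: machine_output_mbind machine_output_mlift map_pmf_def)

lemma query_bounded_nonneg: "query_bounded M I b \<Longrightarrow> 0 \<le> b"
  using set_pmf_not_empty[of M] by (fastforce simp: query_bounded_def)

lemma query_bounded_mono:
  "query_bounded M I b \<Longrightarrow> I \<subseteq> J \<Longrightarrow> b \<le> c \<Longrightarrow> query_bounded M J c"
  by (fastforce simp: query_bounded_def)

lemma query_bounded_mlift: "query_bounded (mlift p) I 0"
  by (auto simp: query_bounded_def mlift_def)

lemma query_bounded_mquery: "q \<in> I \<Longrightarrow> query_bounded (mquery q) I 1"
  by (auto simp: query_bounded_def mquery_def)

lemma query_bounded_mreindex: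
  "query_bounded M I b \<Longrightarrow> h ` I \<subseteq> J \<Longrightarrow> query_bounded (mreindex h M) J b"
  by (fastforce simp: query_bounded_def mreindex_def depth_map_dtree dtree.set_map)

lemma query_bounded_tree_bind:
  assumes "\<And>a. query_bounded (g a) I c" and "positions t \<subseteq> I"
  shows "query_bounded (tree_bind t g) I (real (depth t) + c)"
  using assms(2)
proof (induction t)
  case (Query q l r)
  have "query_bounded (tree_bind l g) I (real (max (depth l) (depth r)) + c)"
    "query_bounded (tree_bind r g) I (real (max (depth l) (depth r)) + c)"
    using Query by (auto intro: query_bounded_mono)
  then show ?case
    using Query.prems by (fastforce simp: query_bounded_def)
qed (simp add: assms)

lemma query_bounded_mbind:
  assumes "query_bounded M I b" and "\<And>a. query_bounded (g a) I c"
  shows "query_bounded (mbind M g) I (b + c)"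
proof -
  have "query_bounded (tree_bind t g) I (b + c)" if "t \<in> set_pmf M" for t
  proof (rule query_bounded_mono[OF query_bounded_tree_bind])
    show "positions t \<subseteq> I" "real (depth t) + c \<le> b + c"
      using assms(1) that by (auto simp: query_bounded_def)
  qed (use assms in auto)
  then show ?thesis
    by (auto simp: query_bounded_def mbind_def)
qed

lemma query_bounded_mseq:
  assumes "\<And>M. M \<in> set Ms \<Longrightarrow> query_bounded M I b"
  shows "query_bounded (mseq Ms) I (real (length Ms) * b)"
  using assms
proof (induction Ms)
  case (Cons M Ms)
  have "query_bounded (mseq (M # Ms)) I (b + (real (length Ms) * b + 0))"
    unfolding mseq.simps using Cons by (intro query_bounded_mbind query_bounded_mlift) auto
  then show ?case
    by (simp add: algebra_simps)
qed (simp add: query_bounded_mlift)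

section \<open>Strings\<close>

lemma finite_strings [simp]: "finite (strings n)"
proof -
  have "strings n = {xs. set xs \<subseteq> UNIV \<and> length xs = n}"
    by (simp add: strings_def)
  then show ?thesis
    by (simp only: finite_lists_length_eq[OF finite])
qed

lemma hdist_nonneg: "0 \<le> hdist n x y"
  by (simp add: hdist_def)

lemma hdist_le_1: "hdist n x y \<le> 1"
proof -
  have "card {i. i < n \<and> x ! i \<noteq> y ! i} \<le> card {..<n}"
    by (rule card_mono) auto
  then show ?thesis
    by (cases "n = 0") (auto simp: hdist_def)
qed

lemma prob_disagree:
  assumes "1 \<le> n"
  shows "measure_pmf.prob (pmf_of_set {..<n}) {i. x ! i \<noteq> y ! i} = hdist n x y"
proof -
  have "{..<n} \<inter> {i. x ! i \<noteq> y ! i} = {i. i < n \<and> x ! i \<noteq> y ! i}"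
    by auto
  then show ?thesis
    using assms by (subst measure_pmf_of_set) (auto simp: hdist_def lessThan_empty_iff)
qed

lemma prob_agree:
  assumes "1 \<le> n"
  shows "measure_pmf.prob (pmf_of_set {..<n}) {i. x ! i = y ! i} = 1 - hdist n x y"
proof -
  have "UNIV - {i. x ! i \<noteq> y ! i} = {i. x ! i = y ! i}"
    by auto
  then show ?thesis
    using measure_pmf.prob_compl[of "{i. x ! i \<noteq> y ! i}" "pmf_of_set {..<n}"] prob_disagree[OF assms, of x y]
    by simp
qed

section \<open>Label-invariant testing depends only on collisions\<close>

definition same_pattern :: "'a list \<Rightarrow> 'b list \<Rightarrow> bool" where
  "same_pattern xs ys \<longleftrightarrow> length xs = length ys \<and>
     (\<forall>i<length xs. \<forall>j<length xs. xs ! i = xs ! j \<longleftrightarrow> ys ! i = ys ! j)"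

lemma same_pattern_commute: "same_pattern xs ys \<longleftrightarrow> same_pattern ys xs"
  by (auto simp: same_pattern_def)

lemma same_pattern_trans: "same_pattern xs ys \<Longrightarrow> same_pattern ys zs \<Longrightarrow> same_pattern xs zs"
  by (simp add: same_pattern_def)

lemma same_pattern_map: "inj_on f (set xs) \<Longrightarrow> same_pattern xs (map f xs)"
  by (auto simp: same_pattern_def inj_on_def)

lemma same_pattern_imp_map:
  assumes "same_pattern xs ys"
  obtains f where "inj_on f (set xs)" "map f xs = ys"
proof
  \<comment> \<open>An arbitrary occurrence of \<open>x\<close>; equality of patterns makes
    \<open>ys ! ix x\<close> the same for all of them.\<close>
  define ix where "ix x = (SOME i. i < length xs \<and> xs ! i = x)" for x
  let ?f = "\<lambda>x. ys ! ix x"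
  have ix: "ix x < length xs \<and> xs ! ix x = x" if "x \<in> set xs" for x
    unfolding ix_def by (rule someI_ex) (use that in \<open>auto simp: in_set_conv_nth\<close>)
  show "inj_on ?f (set xs)"
  proof (rule inj_onI)
    fix x y assume "x \<in> set xs" "y \<in> set xs" and eq: "?f x = ?f y"
    note ix = ix[OF this(1)] ix[OF this(2)]
    have "xs ! ix x = xs ! ix y"
      using assms eq ix unfolding same_pattern_def by blast
    then show "x = y" using ix by simp
  qed
  show "map ?f xs = ys"
  proof (rule nth_equalityI)
    show "length (map ?f xs) = length ys"
      using assms by (simp add: same_pattern_def)
    fix i assume "i < length (map ?f xs)"
    then show "map ?f xs ! i = ys ! i"
      using assms ix[of "xs ! i"] by (auto simp: same_pattern_def)
  qed
qed

text \<open>Injectivity gives the complements of \<open>A\<close> and of its image in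
  \<open>S\<close> equal size, so any bijection between them completes \<open>f\<close>.\<close>

lemma inj_on_extend_permutes:
  assumes "finite S" "A \<subseteq> S" "inj_on f A" "f ` A \<subseteq> S"
  obtains \<pi> where "\<pi> permutes S" "\<And>x. x \<in> A \<Longrightarrow> \<pi> x = f x"
proof -
  have "card (S - A) = card (S - f ` A)"
    using assms by (simp add: card_Diff_subset finite_subset card_image)
  then obtain g where g: "bij_betw g (S - A) (S - f ` A)"
    using assms(1) finite_same_card_bij[of "S - A" "S - f ` A"] by auto
  let ?h = "\<lambda>x. if x \<in> A then f x else g x"
  have "bij_betw ?h (A \<union> (S - A)) (f ` A \<union> (S - f ` A))"
    using g assms by (intro bij_betw_disjoint_Un) (auto simp: bij_betw_def)
  moreover have "A \<union> (S - A) = S" "f ` A \<union> (S - f ` A) = S"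
    using assms by auto
  ultimately have "bij_betw ?h S S" by simp
  then have "(\<lambda>x. if x \<in> S then ?h x else x) permutes S"
    by (intro bij_imp_permutes) (auto cong: bij_betw_cong)
  then show thesis
    using assms(2) by (intro that[of "\<lambda>x. if x \<in> S then ?h x else x"]) auto
qed

lemma label_invariant_permutes:
  assumes "label_invariant n E" "\<pi> permutes strings n" "P \<in> dists n"
  shows "map_pmf \<pi> P \<in> E \<longleftrightarrow> P \<in> E"
  using assms permutes_imp_bij unfolding label_invariant_def by blast

lemma map_pmf_dists: "\<pi> permutes strings n \<Longrightarrow> P \<in> dists n \<Longrightarrow> map_pmf \<pi> P \<in> dists n"
  unfolding dists_def using permutes_in_image by fastforce

lemma tv_dist_permutes:
  assumes "\<pi> permutes strings n"
  shows "tv_dist n (map_pmf \<pi> P) (map_pmf \<pi> Q) = tv_dist n P Q"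
proof -
  have "(\<Sum>x\<in>strings n. \<bar>pmf (map_pmf \<pi> P) x - pmf (map_pmf \<pi> Q) x\<bar>) =
    (\<Sum>x\<in>strings n. \<bar>pmf (map_pmf \<pi> P) (\<pi> x) - pmf (map_pmf \<pi> Q) (\<pi> x)\<bar>)"
    by (rule sum.reindex_bij_betw[OF permutes_imp_bij[OF assms], symmetric])
  then show ?thesis
    using permutes_inj[OF assms] by (simp add: tv_dist_def pmf_map_inj')
qed

text \<open>A member of \<open>E\<close> near the relabelled \<open>P\<close> would pull back along
  \<open>inv \<pi>\<close> to a member of \<open>E\<close> equally near to \<open>P\<close>.\<close>

lemma tv_far_permutes:
  assumes "label_invariant n E" "E \<subseteq> dists n" "\<pi> permutes strings n" "tv_far n \<epsilon> P E"
  shows "tv_far n \<epsilon> (map_pmf \<pi> P) E"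
  unfolding tv_far_def
proof
  fix Q assume Q: "Q \<in> E"
  let ?Q = "map_pmf (inv \<pi>) Q"
  have "?Q \<in> dists n"
    using map_pmf_dists[OF permutes_inv[OF assms(3)]] Q assms(2) by blast
  moreover have eq: "map_pmf \<pi> ?Q = Q"
    using permutes_inverses[OF assms(3)] by (simp add: map_pmf_comp)
  ultimately have "?Q \<in> E"
    using label_invariant_permutes[OF assms(1,3)] Q by metis
  then have "tv_dist n P ?Q > \<epsilon>"
    using assms(4) by (simp add: tv_far_def)
  then show "tv_dist n (map_pmf \<pi> P) Q > \<epsilon>"
    using tv_dist_permutes[OF assms(3), of P ?Q] eq by simp
qed

definition symmetrize :: "nat \<Rightarrow> (bool list list \<Rightarrow> 'a pmf) \<Rightarrow> bool list list \<Rightarrow> 'a pmf" where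
  "symmetrize n T zs = bind_pmf (pmf_of_set {\<pi>. \<pi> permutes strings n}) (\<lambda>\<pi>. T (map \<pi> zs))"

lemma set_pmf_permutations:
  "set_pmf (pmf_of_set {\<pi>. \<pi> permutes strings n}) = {\<pi>. \<pi> permutes strings n}"
  by (rule set_pmf_of_set) (auto intro: permutes_id finite_permutations)

text \<open>Composition with \<sigma> is a bijection on the permutations, so it preserves their
  uniform distribution.\<close>

lemma symmetrize_permutes:
  assumes "\<sigma> permutes strings n"
  shows "symmetrize n T (map \<sigma> zs) = symmetrize n T zs"
proof -
  let ?A = "{\<pi>. \<pi> permutes strings n}"
  have "bij_betw (\<lambda>\<pi>. \<pi> \<circ> \<sigma>) ?A ?A"
  proof (rule bij_betwI[where g = "\<lambda>\<pi>. \<pi> \<circ> inv \<sigma>"])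
    show "(\<lambda>\<pi>. \<pi> \<circ> \<sigma>) \<in> ?A \<rightarrow> ?A" "(\<lambda>\<pi>. \<pi> \<circ> inv \<sigma>) \<in> ?A \<rightarrow> ?A"
      using assms by (auto intro: permutes_compose permutes_inv)
  qed (simp_all add: comp_assoc permutes_inv_o[OF assms])
  then have "map_pmf (\<lambda>\<pi>. \<pi> \<circ> \<sigma>) (pmf_of_set ?A) = pmf_of_set ?A"
    by (intro map_pmf_of_set_bij_betw) (auto intro: permutes_id finite_permutations)
  then have "symmetrize n T zs = bind_pmf (map_pmf (\<lambda>\<pi>. \<pi> \<circ> \<sigma>) (pmf_of_set ?A)) (\<lambda>\<pi>. T (map \<pi> zs))"
    by (simp add: symmetrize_def)
  then show ?thesis
    by (simp add: symmetrize_def bind_map_pmf)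
qed

text \<open>The matching of entries extends to a permutation of all strings, to which
  \<open>symmetrize\<close> is blind.\<close>

lemma symmetrize_cong_pattern:
  assumes "same_pattern xs ys" "set xs \<subseteq> strings n" "set ys \<subseteq> strings n"
  shows "symmetrize n T xs = symmetrize n T ys"
proof -
  obtain f where f: "inj_on f (set xs)" "map f xs = ys"
    using same_pattern_imp_map[OF assms(1)] .
  moreover have "f ` set xs \<subseteq> strings n"
    using f(2) assms(3) by auto
  ultimately obtain \<pi> where "\<pi> permutes strings n" "\<And>x. x \<in> set xs \<Longrightarrow> \<pi> x = f x"
    using inj_on_extend_permutes[OF finite_strings assms(2), of f] by blast
  then show ?thesis
    using symmetrize_permutes[of \<pi> n T xs] f(2) by (metis map_cong)
qed

text \<open>Relabelling the samples amounts to relabelling the distribution, and label invariance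
  transfers both guarantees of the tester to each relabelled distribution.\<close>

lemma bind_replicate_symmetrize:
  "bind_pmf (replicate_pmf m P) (symmetrize n T) =
     bind_pmf (pmf_of_set {\<pi>. \<pi> permutes strings n})
       (\<lambda>\<pi>. bind_pmf (replicate_pmf m (map_pmf \<pi> P)) T)"
  unfolding symmetrize_def
  by (subst bind_commute_pmf) (simp add: bind_map_pmf flip: map_replicate_pmf)

section \<open>Amplification of the standard tester\<close>

definition majority :: "bool list \<Rightarrow> bool" where
  "majority bs \<longleftrightarrow> length bs < 2 * length (filter id bs)"

lemma prob_majority:
  assumes "pmf p b \<ge> 2/3"
  shows "pmf (map_pmf majority (replicate_pmf (2 * r) p)) b \<ge> 1 - (8/9) ^ r"
proof -
  \<comment> \<open>Fewer than \<open>r\<close> wrong votes among \<open>2 * r\<close> exclude a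
    tie, which \<open>majority\<close> would resolve as False.\<close>
  have *: "majority ys = b"
    if "ys \<in> set_pmf (replicate_pmf (2 * r) p)" "length (filter (\<lambda>y. y \<noteq> b) ys) < r" for ys
  proof -
    have len: "length ys = 2 * r"
      using that by (simp add: set_replicate_pmf)
    have "length (filter (\<lambda>y. y = b) ys) + length (filter (\<lambda>y. y \<noteq> b) ys) = 2 * r"
      using sum_length_filter_compl[of "\<lambda>y. y = b" ys] len by simp
    then show ?thesis
      using that len by (cases b) (auto simp: majority_def id_def)
  qed
  have "1 - (8/9) ^ r \<le> measure_pmf.prob (replicate_pmf (2 * r) p) {ys. length (filter (\<lambda>y. y \<notin> {b}) ys) < r}"
    using assms by (intro prob_replicate_pmf_majority) (simp add: measure_pmf_single)
  also have "\<dots> \<le> measure_pmf.prob (replicate_pmf (2 * r) p) (majority -` {b})"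
    by (rule measure_pmf.finite_measure_mono_AE) (auto simp: AE_measure_pmf_iff *)
  finally show ?thesis
    by (simp add: pmf_map)
qed

primrec run_blocks :: "nat \<Rightarrow> ('a list \<Rightarrow> 'b pmf) \<Rightarrow> nat \<Rightarrow> 'a list \<Rightarrow> 'b list pmf" where
  "run_blocks m T 0 zs = return_pmf []"
| "run_blocks m T (Suc r) zs =
     bind_pmf (T (take m zs)) (\<lambda>b. map_pmf (Cons b) (run_blocks m T r (drop m zs)))"

text \<open>Consecutive blocks of independent samples are independent, so the verdicts are
  independent runs of \<open>T\<close>.\<close>

lemma bind_replicate_run_blocks:
  "bind_pmf (replicate_pmf (r * m) P) (run_blocks m T r) =
     replicate_pmf r (bind_pmf (replicate_pmf m P) T)"
proof (induction r)
  case (Suc r)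
  have "bind_pmf (replicate_pmf (Suc r * m) P) (run_blocks m T (Suc r)) =
    bind_pmf (replicate_pmf m P) (\<lambda>xs. bind_pmf (replicate_pmf (r * m) P) (\<lambda>ys.
       bind_pmf (T xs) (\<lambda>b. map_pmf (Cons b) (run_blocks m T r ys))))"
    by (auto simp: replicate_pmf_distrib bind_assoc_pmf bind_return_pmf set_replicate_pmf
        intro!: bind_pmf_cong)
  also have "\<dots> = bind_pmf (replicate_pmf m P) (\<lambda>xs. bind_pmf (T xs) (\<lambda>b.
       map_pmf (Cons b) (bind_pmf (replicate_pmf (r * m) P) (run_blocks m T r))))"
    by (subst bind_commute_pmf) (simp add: map_bind_pmf)
  also have "\<dots> = replicate_pmf (Suc r) (bind_pmf (replicate_pmf m P) T)"
    by (simp only: Suc.IH) (simp add: bind_assoc_pmf map_pmf_def)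
  finally show ?case .
qed (simp add: bind_return_pmf)

text \<open>Amplification comes first, then one permutation is averaged over for all blocks
  together. The bound holds for each fixed permutation and hence for the average, and the verdict
  depends on the collision pattern of the whole sample list.\<close>

lemma amplified_symmetric_tester:
  assumes "label_invariant n E" "E \<subseteq> dists n"
    and "\<And>P. P \<in> dists n \<Longrightarrow> P \<in> E \<Longrightarrow> pmf (bind_pmf (replicate_pmf m P) T) True \<ge> 2/3"
    and "\<And>P. P \<in> dists n \<Longrightarrow> tv_far n \<epsilon> P E \<Longrightarrow> pmf (bind_pmf (replicate_pmf m P) T) False \<ge> 2/3"
  obtains T' where
    "\<And>P. P \<in> dists n \<Longrightarrow> P \<in> E \<Longrightarrow> pmf (bind_pmf (replicate_pmf (2 * r * m) P) T') True \<ge> 1 - (8/9) ^ r"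
    "\<And>P. P \<in> dists n \<Longrightarrow> tv_far n \<epsilon> P E \<Longrightarrow>
       pmf (bind_pmf (replicate_pmf (2 * r * m) P) T') False \<ge> 1 - (8/9) ^ r"
    "\<And>xs ys. same_pattern xs ys \<Longrightarrow> set xs \<subseteq> strings n \<Longrightarrow> set ys \<subseteq> strings n \<Longrightarrow> T' xs = T' ys"
proof
  define U where "U zs = map_pmf majority (run_blocks m T (2 * r) zs)" for zs
  have amp: "pmf (bind_pmf (replicate_pmf (2 * r * m) P) U) b \<ge> 1 - (8/9) ^ r"
    if "pmf (bind_pmf (replicate_pmf m P) T) b \<ge> 2/3" for P b
    using prob_majority[OF that, of r] unfolding U_def
    by (simp flip: map_bind_pmf add: bind_replicate_run_blocks)
  have sym: "pmf (bind_pmf (replicate_pmf (2 * r * m) P) (symmetrize n U)) b \<ge> 1 - (8/9) ^ r"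
    if "\<And>\<pi>. \<pi> permutes strings n \<Longrightarrow> pmf (bind_pmf (replicate_pmf m (map_pmf \<pi> P)) T) b \<ge> 2/3" for P b
  proof -
    have "1 - (8/9) ^ r - 0 \<le> measure_pmf.prob (bind_pmf (pmf_of_set {\<pi>. \<pi> permutes strings n})
       (\<lambda>\<pi>. bind_pmf (replicate_pmf (2 * r * m) (map_pmf \<pi> P)) U)) {b}"
      by (rule prob_bind_pmf_ge[where A = UNIV])
         (auto simp: set_pmf_permutations measure_pmf_single intro: amp that)
    then show ?thesis
      by (simp add: bind_replicate_symmetrize measure_pmf_single)
  qed
  show "pmf (bind_pmf (replicate_pmf (2 * r * m) P) (symmetrize n U)) True \<ge> 1 - (8/9) ^ r"
    if "P \<in> dists n" "P \<in> E" for P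
    using that assms(1) by (intro sym assms(3)) (simp_all add: map_pmf_dists label_invariant_permutes)
  show "pmf (bind_pmf (replicate_pmf (2 * r * m) P) (symmetrize n U)) False \<ge> 1 - (8/9) ^ r"
    if "P \<in> dists n" "tv_far n \<epsilon> P E" for P
    using that assms(1,2) by (intro sym assms(4)) (simp_all add: map_pmf_dists tv_far_permutes)
  show "symmetrize n U xs = symmetrize n U ys"
    if "same_pattern xs ys" "set xs \<subseteq> strings n" "set ys \<subseteq> strings n" for xs ys
    using symmetrize_cong_pattern[OF that] .
qed

section \<open>Earth mover's distance to a corrected distribution\<close>

lemma sum_pmf_strings: "P \<in> dists n \<Longrightarrow> (\<Sum>x\<in>strings n. pmf P x) = 1"
  by (rule sum_pmf_eq_1) (auto simp: dists_def)

lemma emd_le: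
  assumes "w \<in> transport_plans n P Q"
  shows "emd n P Q \<le> (\<Sum>x\<in>strings n. \<Sum>y\<in>strings n. w x y * hdist n x y)"
  unfolding emd_def
proof (rule cINF_lower[OF _ assms])
  show "bdd_below ((\<lambda>w. \<Sum>x\<in>strings n. \<Sum>y\<in>strings n. w x y * hdist n x y) ` transport_plans n P Q)"
    by (rule bdd_belowI2[where m = 0])
       (auto simp: transport_plans_def intro!: sum_nonneg mult_nonneg_nonneg hdist_nonneg)
qed

lemma expectation_strings:
  fixes g :: "bool list \<Rightarrow> real"
  shows "P \<in> dists n \<Longrightarrow> measure_pmf.expectation P g = (\<Sum>x\<in>strings n. pmf P x * g x)"
  by (subst integral_measure_pmf_real[of "strings n"]) (auto simp: dists_def mult.commute)

lemma sum_map_pmf_strings: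
  fixes g :: "bool list \<Rightarrow> real"
  assumes "P \<in> dists n" "map_pmf \<kappa> P \<in> dists n"
  shows "(\<Sum>x\<in>strings n. pmf P x * g (\<kappa> x)) = (\<Sum>z\<in>strings n. pmf (map_pmf \<kappa> P) z * g z)"
  using assms by (simp flip: expectation_strings)

text \<open>The plan sends \<open>x\<close> to \<open>\<kappa> x\<close> and from there along a maximal coupling of \<open>map_pmf \<kappa> P\<close> and \<open>R\<close>,
  so only the mass that the coupling moves pays more than \<open>hdist n x (\<kappa> x)\<close>.\<close>

lemma emd_map_pmf_le:
  assumes P: "P \<in> dists n" and Q: "map_pmf \<kappa> P \<in> dists n" and R: "R \<in> dists n"
  shows "emd n P R \<le> measure_pmf.expectation P (\<lambda>x. hdist n x (\<kappa> x)) + tv_dist n (map_pmf \<kappa> P) R"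
proof -
  let ?S = "strings n"
  define Q where "Q = map_pmf \<kappa> P"
  \<comment> \<open>The mass of \<open>R\<close> not covered by the common part of \<open>Q\<close>
    and \<open>R\<close>. It equals the uncovered mass of \<open>Q\<close>, hence the total
    variation distance.\<close>
  define t where "t = (\<Sum>y\<in>?S. pmf R y - min (pmf Q y) (pmf R y))"
  have QS: "Q \<in> dists n" using assms by (simp add: Q_def)
  have t': "t = (\<Sum>y\<in>?S. pmf Q y - min (pmf Q y) (pmf R y))"
    unfolding t_def sum_subtractf using sum_pmf_strings[OF QS] sum_pmf_strings[OF R] by simp
  have t_nonneg: "0 \<le> t"
    unfolding t_def by (intro sum_nonneg) auto
  have tv: "t = tv_dist n Q R"
  proof -
    have "2 * t = (\<Sum>y\<in>?S. (pmf R y - min (pmf Q y) (pmf R y)) + (pmf Q y - min (pmf Q y) (pmf R y)))"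
      unfolding sum.distrib using t_def t' by simp
    also have "\<dots> = (\<Sum>y\<in>?S. \<bar>pmf Q y - pmf R y\<bar>)"
      by (intro sum.cong) (auto simp: min_def)
    finally show ?thesis by (simp add: tv_dist_def)
  qed
  \<comment> \<open>\<open>r z\<close> is the share of the mass at \<open>z\<close> that stays,
    \<open>e\<close> the law of the arrival points of moved mass. Division by zero makes
    \<open>r z = 0\<close> off the support of \<open>Q\<close>, and \<open>e = 0\<close> when
    \<open>t = 0\<close>.\<close>
  define r where "r z = min (pmf Q z) (pmf R z) / pmf Q z" for z
  define e where "e y = (pmf R y - min (pmf Q y) (pmf R y)) / t" for y
  have r: "0 \<le> r z" "r z \<le> 1" for z
    by (auto simp: r_def divide_le_eq_1 pmf_nonneg less_le)
  have e: "0 \<le> e y" for y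
    using t_nonneg by (simp add: e_def)
  have Qr: "pmf Q z * r z = min (pmf Q z) (pmf R z)" for z
    by (auto simp: r_def min_def pmf_nonneg)
  have Q1r: "(\<Sum>z\<in>?S. pmf Q z * (1 - r z)) = t"
    unfolding t' by (intro sum.cong) (simp_all add: right_diff_distrib Qr)
  have te: "t * e y = pmf R y - min (pmf Q y) (pmf R y)" if "y \<in> ?S" for y
  proof (cases "t = 0")
    case True
    have "\<forall>y\<in>?S. pmf R y - min (pmf Q y) (pmf R y) = 0"
      using True unfolding t_def by (subst (asm) sum_nonneg_eq_0_iff) auto
    then show ?thesis using True that by simp
  qed (simp add: e_def)
  define k where "k z y = (if z = y then r z else 0) + (1 - r z) * e y" for z y
  define w where "w x y = pmf P x * k (\<kappa> x) y" for x y
  have k_nonneg: "0 \<le> k z y" for z y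
    using r[of z] e[of y] by (auto simp: k_def)
  have Qk: "(\<Sum>z\<in>?S. pmf Q z * k z y) = pmf R y" if y: "y \<in> ?S" for y
  proof -
    have "(\<Sum>z\<in>?S. pmf Q z * k z y) =
       (\<Sum>z\<in>?S. (if z = y then pmf Q z * r z else 0) + (pmf Q z * (1 - r z)) * e y)"
      by (intro sum.cong) (auto simp: k_def algebra_simps)
    also have "\<dots> = pmf Q y * r y + t * e y"
      unfolding sum.distrib using y by (simp flip: sum_distrib_right add: Q1r)
    also have "\<dots> = pmf R y"
      using te[OF y] Qr[of y] by simp
    finally show ?thesis .
  qed
  have sum_k: "(\<Sum>y\<in>?S. k z y) = 1" if "z \<in> ?S" "0 < pmf Q z" for z
  proof -
    have "(\<Sum>y\<in>?S. k z y) = r z + (1 - r z) * (\<Sum>y\<in>?S. e y)"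
      unfolding k_def sum.distrib using that by (simp flip: sum_distrib_left)
    \<comment> \<open>For \<open>t = 0\<close> the weights \<open>e\<close> sum to 0 rather than 1,
      but then \<open>r z = 1\<close> on the support of \<open>Q\<close> and no mass moves.\<close>
    moreover have "(1 - r z) * (\<Sum>y\<in>?S. e y) = 1 - r z"
    proof (cases "t = 0")
      case True
      have "\<forall>z\<in>?S. pmf Q z * (1 - r z) = 0"
        using Q1r True r sum_nonneg_eq_0_iff[of ?S "\<lambda>z. pmf Q z * (1 - r z)"] by simp
      then show ?thesis using that by auto
    next
      case False
      then have "(\<Sum>y\<in>?S. e y) = 1"
        unfolding e_def by (simp flip: sum_divide_distrib t_def)
      then show ?thesis by simp
    qed
    ultimately show ?thesis by simp
  qed
  have row: "(\<Sum>y\<in>?S. w x y) = pmf P x" if "x \<in> ?S" for x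
  proof (cases "pmf P x = 0")
    case False
    then have "\<kappa> x \<in> set_pmf Q"
      by (simp add: Q_def set_pmf_iff)
    then have "\<kappa> x \<in> ?S" "0 < pmf Q (\<kappa> x)"
      using QS by (auto simp: dists_def pmf_positive)
    then show ?thesis
      unfolding w_def by (simp flip: sum_distrib_left add: sum_k)
  qed (simp add: w_def)
  have "w \<in> transport_plans n P R"
    unfolding transport_plans_def
  proof (intro CollectI conjI ballI)
    show "(\<Sum>x\<in>?S. w x y) = pmf R y" if "y \<in> ?S" for y
      unfolding w_def using sum_map_pmf_strings[OF P assms(2), of "\<lambda>z. k z y"] Qk[OF that]
      by (simp add: Q_def)
  qed (use row k_nonneg in \<open>auto simp: w_def\<close>)
  then have "emd n P R \<le> (\<Sum>x\<in>?S. \<Sum>y\<in>?S. w x y * hdist n x y)"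
    by (rule emd_le)
  \<comment> \<open>Mass moved by the coupling is charged the maximal distance 1; for
    \<open>y = \<kappa> x\<close> the two distances agree.\<close>
  also have "\<dots> \<le> (\<Sum>x\<in>?S. \<Sum>y\<in>?S. w x y * hdist n x (\<kappa> x) + pmf P x * ((1 - r (\<kappa> x)) * e y))"
  proof (intro sum_mono)
    fix x y
    have "k (\<kappa> x) y * hdist n x y \<le> k (\<kappa> x) y * hdist n x (\<kappa> x) + (1 - r (\<kappa> x)) * e y"
    proof (cases "\<kappa> x = y")
      case True
      then show ?thesis using r[of y] e[of y] by simp
    next
      case False
      have "k (\<kappa> x) y * hdist n x y \<le> k (\<kappa> x) y * 1"
        using k_nonneg hdist_le_1 by (rule mult_left_mono[rotated])
      moreover have "0 \<le> k (\<kappa> x) y * hdist n x (\<kappa> x)"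
        using k_nonneg hdist_nonneg by simp
      ultimately show ?thesis using False by (simp add: k_def)
    qed
    then have "pmf P x * (k (\<kappa> x) y * hdist n x y) \<le>
        pmf P x * (k (\<kappa> x) y * hdist n x (\<kappa> x) + (1 - r (\<kappa> x)) * e y)"
      by (rule mult_left_mono) simp
    then show "w x y * hdist n x y \<le> w x y * hdist n x (\<kappa> x) + pmf P x * ((1 - r (\<kappa> x)) * e y)"
      by (simp add: w_def algebra_simps)
  qed
  also have "\<dots> = (\<Sum>x\<in>?S. pmf P x * hdist n x (\<kappa> x)) + (\<Sum>y\<in>?S. (\<Sum>x\<in>?S. pmf P x * (1 - r (\<kappa> x))) * e y)"
  proof -
    have "(\<Sum>x\<in>?S. \<Sum>y\<in>?S. w x y * hdist n x (\<kappa> x)) = (\<Sum>x\<in>?S. pmf P x * hdist n x (\<kappa> x))"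
      by (intro sum.cong) (simp_all add: row flip: sum_distrib_right)
    moreover have "(\<Sum>x\<in>?S. \<Sum>y\<in>?S. pmf P x * ((1 - r (\<kappa> x)) * e y)) =
        (\<Sum>y\<in>?S. (\<Sum>x\<in>?S. pmf P x * (1 - r (\<kappa> x))) * e y)"
      by (subst sum.swap) (simp add: sum_distrib_right mult.assoc)
    ultimately show ?thesis
      by (simp add: sum.distrib)
  qed
  also have "(\<Sum>x\<in>?S. pmf P x * (1 - r (\<kappa> x))) = t"
    using sum_map_pmf_strings[OF P assms(2), of "\<lambda>z. 1 - r z"] Q1r by (simp add: Q_def)
  also have "(\<Sum>y\<in>?S. t * e y) = t"
    using te unfolding t_def by (intro sum.cong) auto
  finally show ?thesis
    using tv by (simp add: expectation_strings[OF P] Q_def)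
qed

text \<open>Relabelling the strings outside \<open>A\<close> by unused strings of \<open>A\<close> only increases the probabilities
  on \<open>A\<close>, hence does not increase the distance to a distribution on \<open>A\<close>.\<close>

lemma exists_supported_no_farther:
  assumes E: "label_invariant n E" "E \<subseteq> dists n" and A: "A \<subseteq> strings n"
    and Q: "set_pmf Q \<subseteq> A" and R: "R \<in> E" "card (set_pmf R) \<le> card A"
  obtains R' where "R' \<in> E" "set_pmf R' \<subseteq> A" "tv_dist n Q R' \<le> tv_dist n Q R"
proof -
  let ?S = "strings n" and ?B = "set_pmf R"
  have BS: "?B \<subseteq> ?S" using E(2) R(1) by (auto simp: dists_def)
  have fin: "finite ?B" "finite A" using BS A finite_subset[OF _ finite_strings] by auto
  \<comment> \<open>The two differences arise by removing the same intersection from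
    \<open>?B\<close> and from the larger \<open>A\<close>.\<close>
  have "card (?B - A) \<le> card (A - ?B)"
    using R(2) fin by (metis (no_types, lifting) Int_commute card_Diff_subset_Int card_mono diff_le_mono finite_Int inf_le1)
  then obtain g where g: "g ` (?B - A) \<subseteq> A - ?B" "inj_on g (?B - A)"
    using card_le_inj[of "?B - A" "A - ?B"] fin by auto
  let ?f = "\<lambda>x. if x \<in> A then x else g x"
  have "inj_on ?f ?B" "?f ` ?B \<subseteq> A"
    using g by (auto simp: inj_on_def)
  then obtain \<pi> where \<pi>: "\<pi> permutes ?S" "\<And>x. x \<in> ?B \<Longrightarrow> \<pi> x = ?f x"
    using inj_on_extend_permutes[OF finite_strings BS, of ?f] A by blast
  let ?R = "map_pmf \<pi> R"
  have RA: "set_pmf ?R \<subseteq> A"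
    using \<pi>(2) \<open>?f ` ?B \<subseteq> A\<close> by auto
  have ge: "pmf R x \<le> pmf ?R x" if "x \<in> A" for x
  proof (cases "x \<in> ?B")
    case True
    then have "\<pi> x = x" using \<pi>(2) that by simp
    then have "pmf ?R x = pmf R x"
      using pmf_map_inj'[OF permutes_inj[OF \<pi>(1)], of R x] by simp
    then show ?thesis by simp
  qed (simp add: set_pmf_iff)
  \<comment> \<open>In the one-sided form of total variation only points of \<open>A\<close>
    contribute, because \<open>Q\<close> vanishes elsewhere; there \<open>ge\<close>
    applies.\<close>
  have half: "tv_dist n Q R'' = (\<Sum>x\<in>?S. max 0 (pmf Q x - pmf R'' x))" if "R'' \<in> dists n" for R''
  proof -
    have "Q \<in> dists n" using Q A by (auto simp: dists_def)
    then have *: "(\<Sum>x\<in>?S. pmf Q x - pmf R'' x) = 0"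
      using that by (simp add: sum_subtractf sum_pmf_strings)
    have "2 * (\<Sum>x\<in>?S. max 0 (pmf Q x - pmf R'' x)) =
        (\<Sum>x\<in>?S. \<bar>pmf Q x - pmf R'' x\<bar> + (pmf Q x - pmf R'' x))"
      unfolding sum_distrib_left by (intro sum.cong) (auto simp: max_def)
    then show ?thesis
      unfolding sum.distrib * by (simp add: tv_dist_def)
  qed
  have RE: "?R \<in> E"
    using label_invariant_permutes[OF E(1) \<pi>(1)] R(1) E(2) by auto
  have "tv_dist n Q ?R = (\<Sum>x\<in>?S. max 0 (pmf Q x - pmf ?R x))"
    using RE E(2) by (intro half) auto
  also have "\<dots> \<le> (\<Sum>x\<in>?S. max 0 (pmf Q x - pmf R x))"
  proof (rule sum_mono)
    show "max 0 (pmf Q x - pmf ?R x) \<le> max 0 (pmf Q x - pmf R x)" for x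
    proof (cases "x \<in> A")
      case False
      then have "pmf Q x = 0" using Q by (auto simp: set_pmf_iff)
      then show ?thesis by simp
    qed (use ge[of x] in auto)
  qed
  also have "\<dots> = tv_dist n Q R"
    using R(1) E(2) by (intro half[symmetric]) auto
  finally show thesis
    using RE RA by (intro that[of ?R]) auto
qed

text \<open>The even split of the distance budget: some member of \<open>E\<close> is within
  \<open>\<epsilon>' / 2\<close> of the corrected distribution, it can be moved into
  \<open>A\<close> at no loss, and the earth mover's distance above \<epsilon> leaves more than
  \<open>\<epsilon>' / 2\<close> for the correction itself.\<close>

lemma emd_far_cases:
  assumes E: "label_invariant n E" "E \<subseteq> dists n" and A: "A \<subseteq> strings n"
    and card: "\<And>R. R \<in> E \<Longrightarrow> card (set_pmf R) \<le> card A"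
    and P: "P \<in> dists n" and \<kappa>: "\<And>x. x \<in> strings n \<Longrightarrow> \<kappa> x \<in> A"
    and far: "emd_far n \<epsilon> P {R \<in> E. set_pmf R \<subseteq> A}"
    and close: "\<not> tv_far n (\<epsilon>' / 2) (map_pmf \<kappa> P) E" and le: "\<epsilon>' \<le> \<epsilon>"
  shows "\<epsilon>' / 2 < measure_pmf.expectation P (\<lambda>x. hdist n x (\<kappa> x))"
proof -
  have QA: "set_pmf (map_pmf \<kappa> P) \<subseteq> A"
    using P \<kappa> by (auto simp: dists_def)
  then have Q: "map_pmf \<kappa> P \<in> dists n"
    using A by (auto simp: dists_def)
  obtain R where R: "R \<in> E" "tv_dist n (map_pmf \<kappa> P) R \<le> \<epsilon>' / 2"
    using close by (auto simp: tv_far_def not_less)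
  obtain R' where R': "R' \<in> E" "set_pmf R' \<subseteq> A" "tv_dist n (map_pmf \<kappa> P) R' \<le> tv_dist n (map_pmf \<kappa> P) R"
    using exists_supported_no_farther[OF E A QA R(1) card[OF R(1)]] .
  have "\<epsilon> < emd n P R'"
    using far R' by (auto simp: emd_far_def)
  also have "\<dots> \<le> measure_pmf.expectation P (\<lambda>x. hdist n x (\<kappa> x)) + tv_dist n (map_pmf \<kappa> P) R'"
    using R'(1) E(2) by (intro emd_map_pmf_le[OF P Q]) auto
  finally show ?thesis
    using R(2) R'(3) le by simp
qed

section \<open>The tester\<close>

lemma query_bounded_bind_pmf:
  "(\<And>a. a \<in> set_pmf p \<Longrightarrow> query_bounded (g a) I b) \<Longrightarrow> query_bounded (bind_pmf p g) I b"
  by (auto simp: query_bounded_def)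

lemma machine_output_bind_pmf:
  "machine_output (bind_pmf p g) f = bind_pmf p (\<lambda>a. machine_output (g a) f)"
  by (simp add: machine_output_def map_bind_pmf)

text \<open>A bit wins only with more than half of all votes, failures included. Thus fewer than
  half wrong bits can never elect the wrong bit, however many votes are failures.\<close>

definition majority_option :: "bool option list \<Rightarrow> bool option" where
  "majority_option vs =
     (if length vs < 2 * length (filter (\<lambda>v. v = Some True) vs) then Some True
      else if length vs < 2 * length (filter (\<lambda>v. v = Some False) vs) then Some False
      else None)"

definition amplify :: "('b list \<Rightarrow> 'b) \<Rightarrow> nat \<Rightarrow> ('q, 'b) machine \<Rightarrow> ('q, 'b) machine" where
  "amplify maj r M = mbind (mseq (replicate (2 * r) M)) (\<lambda>ys. mlift (return_pmf (maj ys)))"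

lemma machine_output_amplify:
  "machine_output (amplify maj r M) f = map_pmf maj (replicate_pmf (2 * r) (machine_output M f))"
  by (simp add: amplify_def machine_output_mbind machine_output_mlift machine_output_mseq
      seq_pmf_replicate map_pmf_def)

lemma query_bounded_amplify:
  assumes "query_bounded M I b"
  shows "query_bounded (amplify maj r M) I (2 * real r * b)"
proof -
  have "query_bounded (amplify maj r M) I (real (length (replicate (2 * r) M)) * b + 0)"
    unfolding amplify_def
    by (rule query_bounded_mbind[OF query_bounded_mseq query_bounded_mlift]) (use assms in auto)
  then show ?thesis by simp
qed

lemma prob_amplify_ge:
  assumes "measure_pmf.prob (machine_output M f) S \<ge> 2/3"
    and "\<And>ys. length ys = 2 * r \<Longrightarrow> length (filter (\<lambda>y. y \<notin> S) ys) < r \<Longrightarrow> maj ys \<in> B"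
  shows "measure_pmf.prob (machine_output (amplify maj r M) f) B \<ge> 1 - (8/9) ^ r"
proof -
  let ?R = "replicate_pmf (2 * r) (machine_output M f)"
  have "1 - (8/9) ^ r \<le> measure_pmf.prob ?R {ys. length (filter (\<lambda>y. y \<notin> S) ys) < r}"
    by (rule prob_replicate_pmf_majority[OF assms(1)])
  also have "\<dots> \<le> measure_pmf.prob ?R (maj -` B)"
    by (rule measure_pmf.finite_measure_mono_AE)
       (auto simp: AE_measure_pmf_iff set_replicate_pmf intro: assms(2))
  finally show ?thesis
    by (simp add: machine_output_amplify)
qed

lemma majority_option_sound:
  assumes "length vs = 2 * r" "length (filter (\<lambda>v. v \<notin> {Some b, None}) vs) < r"
  shows "majority_option vs \<in> {Some b, None}"
proof -
  have "filter (\<lambda>v. v \<notin> {Some b, None}) vs = filter (\<lambda>v. v = Some (\<not> b)) vs"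
    by (rule filter_cong) auto
  then show ?thesis
    using assms by (cases b) (auto simp: majority_option_def)
qed

lemma majority_option_complete:
  assumes "length vs = 2 * r" "length (filter (\<lambda>v. v \<notin> {Some b}) vs) < r"
  shows "majority_option vs = Some b"
proof -
  have "r < length (filter (\<lambda>v. v = Some b) vs)"
    using sum_length_filter_compl[of "\<lambda>v. v = Some b" vs] assms by simp
  moreover have "length (filter (\<lambda>v. v = Some (\<not> b)) vs) \<le> length (filter (\<lambda>v. v \<notin> {Some b}) vs)"
    by (induction vs) auto
  ultimately show ?thesis
    using assms by (cases b) (auto simp: majority_option_def)
qed

text \<open>One length is fixed. \<open>T\<close> tests at the same distance \<delta> up to which
  \<open>C\<close> corrects, so a string that is not \<delta>-far is in the range of the
  corrector.\<close>

locale self_correcting_property =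
  fixes n :: nat and A :: "bool list set" and \<delta> b\<^sub>T b\<^sub>C :: real
    and T :: "(nat, bool) machine" and C :: "nat \<Rightarrow> (nat, bool option) machine"
  assumes n: "1 \<le> n" and A: "A \<subseteq> strings n" "A \<noteq> {}" and \<delta>: "0 < \<delta>" "\<delta> < 1"
    and T_bounded: "query_bounded T {..<n} b\<^sub>T"
    and T_complete: "\<And>x. x \<in> A \<Longrightarrow> pmf (machine_output T (\<lambda>i. x ! i)) True \<ge> 2/3"
    and T_sound: "\<And>x. x \<in> strings n \<Longrightarrow> far_from n \<delta> x A \<Longrightarrow>
      pmf (machine_output T (\<lambda>i. x ! i)) False \<ge> 2/3"
    and C_bounded: "\<And>i. i < n \<Longrightarrow> query_bounded (C i) {..<n} b\<^sub>C"
    and C_complete: "\<And>i x. i < n \<Longrightarrow> x \<in> A \<Longrightarrow>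
      pmf (machine_output (C i) (\<lambda>j. x ! j)) (Some (x ! i)) \<ge> 2/3"
    and C_sound: "\<And>i x x'. i < n \<Longrightarrow> x \<in> strings n \<Longrightarrow> x' \<in> A \<Longrightarrow> close_to n \<delta> x x' \<Longrightarrow>
      measure_pmf.prob (machine_output (C i) (\<lambda>j. x ! j)) {Some (x' ! i), None} \<ge> 2/3"
begin

text \<open>A codeword within distance \<open>\<delta>\<close> of another one would force two disjoint sets of outputs
  on the corrector, each with probability at least \<open>2/3\<close>.\<close>

lemma hdist_gt:
  assumes x: "x \<in> A" and y: "y \<in> A" and "x \<noteq> y"
  shows "\<delta> < hdist n x y"
proof (rule ccontr)
  assume "\<not> \<delta> < hdist n x y"
  then have "close_to n \<delta> x y" by (simp add: close_to_def)
  obtain i where i: "i < n" "x ! i \<noteq> y ! i"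
    using assms A(1) by (auto simp: strings_def list_eq_iff_nth_eq)
  let ?M = "machine_output (C i) (\<lambda>j. x ! j)"
  have "4/3 \<le> measure_pmf.prob ?M {Some (x ! i)} + measure_pmf.prob ?M {Some (y ! i), None}"
    using C_complete[OF i(1) x] C_sound[OF i(1) _ y \<open>close_to n \<delta> x y\<close>] x A(1)
    by (force simp: measure_pmf_single)
  also have "\<dots> = measure_pmf.prob ?M ({Some (x ! i)} \<union> {Some (y ! i), None})"
    by (rule measure_pmf.finite_measure_Union[symmetric]) (use i in auto)
  also have "\<dots> \<le> 1" by (rule measure_pmf.prob_le_1)
  finally show False by simp
qed

text \<open>A string may be \<delta>-close to several words of \<open>A\<close>; any choice is
  sound, because \<open>C_sound\<close> holds for each close word. The fallback for far strings
  keeps all values in \<open>A\<close>; such strings are left to the rejection by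
  \<open>T\<close>.\<close>

definition correct :: "bool list \<Rightarrow> bool list" where
  "correct x = (if \<exists>z\<in>A. close_to n \<delta> x z then SOME z. z \<in> A \<and> close_to n \<delta> x z else SOME z. z \<in> A)"

lemma correct_close:
  assumes "\<not> far_from n \<delta> x A"
  shows "close_to n \<delta> x (correct x)"
proof -
  have ex: "\<exists>z. z \<in> A \<and> close_to n \<delta> x z"
    using assms by (auto simp: far_from_def close_to_def not_less)
  then show ?thesis
    using someI_ex[OF ex] by (auto simp: correct_def)
qed

lemma correct_in: "correct x \<in> A"
proof (cases "\<exists>z\<in>A. close_to n \<delta> x z")
  case True
  then have "\<exists>z. z \<in> A \<and> close_to n \<delta> x z" by auto
  from someI_ex[OF this] True show ?thesis by (simp add: correct_def)
next
  case False
  then show ?thesis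
    using A(2) someI_ex[of "\<lambda>z. z \<in> A"] by (auto simp: correct_def)
qed

text \<open>The spot-check position \<open>i\<close> is drawn afresh for each sample, whereas
  \<open>I\<close> is a parameter: fingerprints of different samples are comparable only at common
  positions. \<open>None\<close> stands for rejection.\<close>

definition sample_machine :: "nat \<Rightarrow> nat list \<Rightarrow> (nat, bool list option) machine" where
  "sample_machine r I =
     bind_pmf (pmf_of_set {..<n}) (\<lambda>i.
     mbind (amplify majority r T) (\<lambda>t.
     mbind (amplify majority_option r (C i)) (\<lambda>v.
     mbind (mquery i) (\<lambda>b.
     mbind (mseq (map (\<lambda>i. amplify majority_option r (C i)) I)) (\<lambda>vs.
     mlift (return_pmf (if t \<and> v = Some b \<and> None \<notin> set vs then Some (map the vs) else None)))))))"

lemma set_pmf_index: "set_pmf (pmf_of_set {..<n}) = {..<n}"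
  using n by (intro set_pmf_of_set) (auto simp: lessThan_empty_iff)

lemma query_bounded_sample_machine:
  assumes "set I \<subseteq> {..<n}"
  shows "query_bounded (sample_machine r I) {..<n}
    (2 * real r * b\<^sub>T + (2 * real r * b\<^sub>C + (1 + (real (length I) * (2 * real r * b\<^sub>C) + 0))))"
  unfolding sample_machine_def
proof (intro query_bounded_bind_pmf query_bounded_mbind query_bounded_mlift query_bounded_mquery)
  show "query_bounded (mseq (map (\<lambda>i. amplify majority_option r (C i)) I)) {..<n}
      (real (length I) * (2 * real r * b\<^sub>C))"
    using query_bounded_mseq[of "map (\<lambda>i. amplify majority_option r (C i)) I"] assms
    by (force intro: query_bounded_amplify C_bounded)
qed (auto simp: set_pmf_index intro: query_bounded_amplify T_bounded C_bounded)

definition sample_output :: "nat \<Rightarrow> nat list \<Rightarrow> bool list \<Rightarrow> bool list option pmf" where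
  "sample_output r I x = machine_output (sample_machine r I) (\<lambda>i. x ! i)"

text \<open>The output law conditioned on the spot-check position, which lets the error analysis
  average over \<open>i\<close> last.\<close>

definition sample_output_at :: "nat \<Rightarrow> nat list \<Rightarrow> bool list \<Rightarrow> nat \<Rightarrow> bool list option pmf" where
  "sample_output_at r I x i =
     bind_pmf (machine_output (amplify majority r T) (\<lambda>i. x ! i)) (\<lambda>t.
     bind_pmf (machine_output (amplify majority_option r (C i)) (\<lambda>i. x ! i)) (\<lambda>v.
     bind_pmf (seq_pmf (map (\<lambda>i. machine_output (amplify majority_option r (C i)) (\<lambda>i. x ! i)) I)) (\<lambda>vs.
     return_pmf (if t \<and> v = Some (x ! i) \<and> None \<notin> set vs then Some (map the vs) else None))))"

lemma sample_output_eq: "sample_output r I x = bind_pmf (pmf_of_set {..<n}) (sample_output_at r I x)"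
  by (simp add: sample_output_def sample_output_at_def[abs_def] sample_machine_def machine_output_bind_pmf
      machine_output_mbind machine_output_mquery machine_output_mlift machine_output_mseq
      bind_return_pmf comp_def)

section \<open>Error analysis for a single sample\<close>

lemma amplify_T_complete:
  assumes "x \<in> A"
  shows "measure_pmf.prob (machine_output (amplify majority r T) (\<lambda>i. x ! i)) {True} \<ge> 1 - (8/9) ^ r"
  using prob_majority[OF T_complete[OF assms]] by (simp add: machine_output_amplify measure_pmf_single)

lemma amplify_T_sound:
  assumes "x \<in> strings n" "far_from n \<delta> x A"
  shows "measure_pmf.prob (machine_output (amplify majority r T) (\<lambda>i. x ! i)) {False} \<ge> 1 - (8/9) ^ r"
  using prob_majority[OF T_sound[OF assms]] by (simp add: machine_output_amplify measure_pmf_single)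

lemma amplify_C_complete:
  assumes "i < n" "x \<in> A"
  shows "measure_pmf.prob (machine_output (amplify majority_option r (C i)) (\<lambda>j. x ! j)) {Some (x ! i)}
    \<ge> 1 - (8/9) ^ r"
  using C_complete[OF assms]
  by (intro prob_amplify_ge[where S = "{Some (x ! i)}"]) (auto simp: measure_pmf_single majority_option_complete)

lemma amplify_C_sound:
  assumes "i < n" "x \<in> strings n" "close_to n \<delta> x x'" "x' \<in> A"
  shows "measure_pmf.prob (machine_output (amplify majority_option r (C i)) (\<lambda>j. x ! j)) {Some (x' ! i), None}
    \<ge> 1 - (8/9) ^ r"
  by (rule prob_amplify_ge[OF C_sound[OF assms(1,2,4,3)]], rule majority_option_sound)

text \<open>There are \<open>length I + 2\<close> amplified calls: the string tester, the spot check
  and one correction per fingerprint position.\<close>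

lemma sample_output_complete:
  assumes x: "x \<in> A" and I: "set I \<subseteq> {..<n}"
  shows "measure_pmf.prob (sample_output r I x) {Some (map (\<lambda>i. x ! i) I)}
    \<ge> 1 - (real (length I) + 2) * (8/9) ^ r"
proof -
  let ?\<eta> = "(8/9 :: real) ^ r"
  have \<eta>: "0 \<le> ?\<eta>" by simp
  have "measure_pmf.prob (sample_output r I x) {Some (map (\<lambda>i. x ! i) I)}
      \<ge> 1 - real (length I) * ?\<eta> - ?\<eta> - ?\<eta> - 0"
    unfolding sample_output_eq
  proof (rule prob_bind_pmf_ge[where A = UNIV], goal_cases)
    case (2 i)
    then have i: "i < n" by (simp add: set_pmf_index)
    show ?case
      unfolding sample_output_at_def
    proof (rule prob_bind_pmf_ge[OF amplify_T_complete[OF x]], goal_cases)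
      case (1 t)
      show ?case
      proof (rule prob_bind_pmf_ge[OF amplify_C_complete[OF i x]], goal_cases)
        case (1 v)
        have "1 - real (length I) * ?\<eta> \<le> measure_pmf.prob
            (seq_pmf (map (\<lambda>i. machine_output (amplify majority_option r (C i)) (\<lambda>j. x ! j)) I))
            {vs. list_all2 (\<lambda>i v. v \<in> {Some (x ! i)}) I vs}"
          using I by (intro prob_seq_pmf_ge amplify_C_complete x) auto
        from prob_bind_pmf_ge[OF this, where b = 1] show ?case
        proof (rule order_trans[rotated], goal_cases)
          case (1 vs)
          then have "vs = map (\<lambda>i. Some (x ! i)) I"
            by (auto simp: list_all2_conv_all_nth intro: nth_equalityI)
          then show ?case
            using \<open>t \<in> {True}\<close> \<open>v \<in> {Some (x ! i)}\<close> by (auto simp: comp_def)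
        qed auto
      qed (use \<eta> in auto)
    qed (use \<eta> in \<open>auto intro: order_trans[of _ 0]\<close>)
  qed (use \<eta> in \<open>auto intro: order_trans[of _ 0]\<close>)
  then show ?thesis
    by (simp add: algebra_simps)
qed

text \<open>For far \<open>x\<close> the string tester forces \<open>None\<close>. For close
  \<open>x\<close> each fingerprint correction gives the right bit or a failure, and a single
  failure gives \<open>None\<close>; the string tester and the spot check can only add further
  rejections.\<close>

lemma sample_output_sound:
  assumes x: "x \<in> strings n" and I: "set I \<subseteq> {..<n}"
  shows "measure_pmf.prob (sample_output r I x) {Some (map (\<lambda>i. correct x ! i) I), None}
    \<ge> 1 - (real (length I) + 2) * (8/9) ^ r"
proof -
  let ?\<eta> = "(8/9 :: real) ^ r"
  have \<eta>: "0 \<le> ?\<eta>" by simp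
  have "measure_pmf.prob (sample_output r I x) {Some (map (\<lambda>i. correct x ! i) I), None}
      \<ge> 1 - (real (length I) + 1) * ?\<eta> - 0"
    unfolding sample_output_eq
  proof (rule prob_bind_pmf_ge[where A = UNIV], goal_cases)
    case (2 i)
    show ?case
    proof (cases "far_from n \<delta> x A")
      case True
      have "1 - ?\<eta> \<le> measure_pmf.prob (sample_output_at r I x i) {Some (map (\<lambda>i. correct x ! i) I), None}"
        unfolding sample_output_at_def
        by (rule prob_bind_pmf_ge[OF amplify_T_sound[OF x True]]) auto
      moreover have "?\<eta> \<le> (real (length I) + 1) * ?\<eta>"
        by (simp add: algebra_simps)
      ultimately show ?thesis by linarith
    next
      case False
      have "1 - (real (length I) + 1) * ?\<eta> = (1 - real (length I) * ?\<eta> - 0) - ?\<eta>"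
        by (simp add: algebra_simps)
      also have "\<dots> \<le> measure_pmf.prob (sample_output_at r I x i) {Some (map (\<lambda>i. correct x ! i) I), None}"
        unfolding sample_output_at_def
      proof (rule prob_bind_pmf_ge[where A = UNIV], goal_cases)
        case (2 t)
        show ?case
        proof (rule prob_bind_pmf_ge[where A = UNIV], goal_cases)
          case (2 v)
          have "1 - real (length I) * ?\<eta> \<le> measure_pmf.prob
              (seq_pmf (map (\<lambda>i. machine_output (amplify majority_option r (C i)) (\<lambda>j. x ! j)) I))
              {vs. list_all2 (\<lambda>i v. v \<in> {Some (correct x ! i), None}) I vs}"
            using I by (intro prob_seq_pmf_ge amplify_C_sound x correct_in correct_close[OF False]) auto
          from prob_bind_pmf_ge[OF this, where b = 1] show ?case
          proof (rule order_trans[rotated], goal_cases)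
            case (1 vs)
            have "vs = map (\<lambda>i. Some (correct x ! i)) I" if "None \<notin> set vs"
            proof (rule nth_equalityI)
              show "length vs = length (map (\<lambda>i. Some (correct x ! i)) I)"
                using 1 by (auto simp: list_all2_conv_all_nth)
              show "vs ! j = map (\<lambda>i. Some (correct x ! i)) I ! j" if "j < length vs" for j
                using 1 that \<open>None \<notin> set vs\<close> by (auto simp: list_all2_conv_all_nth) (metis nth_mem)
            qed
            then show ?case
              by (auto simp: comp_def)
          qed auto
        qed (use \<eta> in auto)
      qed (use \<eta> in auto)
      finally show ?thesis .
    qed
  qed (use \<eta> in \<open>auto intro: order_trans[of _ 0]\<close>)
  moreover have "(real (length I) + 1) * ?\<eta> \<le> (real (length I) + 2) * ?\<eta>"
    by (simp add: algebra_simps)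
  ultimately show ?thesis
    by linarith
qed

text \<open>A far \<open>x\<close> is rejected by \<open>T\<close> with probability at least 1/2,
  enough since distances are at most 1. Otherwise \<open>i\<close> hits a disagreement with
  probability \<open>hdist\<close>, and then the corrector gives the other bit or a failure with
  probability at least 1/2, both of which fail the comparison.\<close>

lemma sample_output_None:
  assumes x: "x \<in> strings n" and r: "(8/9) ^ r \<le> (1/2 :: real)"
  shows "measure_pmf.prob (sample_output r I x) {None} \<ge> hdist n x (correct x) / 2"
proof (cases "far_from n \<delta> x A")
  case True
  have "1 / 2 - 0 \<le> measure_pmf.prob (sample_output r I x) {None}"
    unfolding sample_output_eq
  proof (rule prob_bind_pmf_ge[where A = UNIV], goal_cases)
    case (2 i)
    have "1 - 1 / 2 \<le> measure_pmf.prob (machine_output (amplify majority r T) (\<lambda>i. x ! i)) {False}"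
      using amplify_T_sound[OF x True, of r] r by linarith
    from prob_bind_pmf_ge[OF this, where b = 1] show ?case
      unfolding sample_output_at_def by (rule order_trans[rotated]) auto
  qed auto
  then show ?thesis
    using hdist_le_1[of n x "correct x"] by simp
next
  case False
  let ?z = "correct x"
  have "measure_pmf.prob (sample_output r I x) {None} \<ge>
     (\<integral>i. (1 / 2) * indicator {i. x ! i \<noteq> ?z ! i} i \<partial>measure_pmf (pmf_of_set {..<n}))"
    unfolding sample_output_eq prob_bind_pmf[of "pmf_of_set {..<n}"]
  proof (rule integral_mono_AE, goal_cases)
    case 3
    show ?case
      unfolding AE_measure_pmf_iff set_pmf_index
    proof
      fix i assume i: "i \<in> {..<n}"
      show "1 / 2 * indicator {i. x ! i \<noteq> ?z ! i} i \<le> measure_pmf.prob (sample_output_at r I x i) {None}"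
      proof (cases "x ! i \<noteq> ?z ! i")
        case True
        have "1 / 2 - 0 \<le> measure_pmf.prob (sample_output_at r I x i) {None}"
          unfolding sample_output_at_def
        proof (rule prob_bind_pmf_ge[where A = UNIV], goal_cases)
          case (2 t)
          have "1 - 1 / 2 \<le> measure_pmf.prob
              (machine_output (amplify majority_option r (C i)) (\<lambda>i. x ! i)) {Some (?z ! i), None}"
            using amplify_C_sound[OF _ x correct_close[OF False] correct_in, of i r] r i by auto
          from prob_bind_pmf_ge[OF this, where b = 1] show ?case
            by (rule order_trans[rotated]) (use True in auto)
        qed auto
        then show ?thesis using True by simp
      qed simp
    qed
  qed (auto intro!: integrable_prob_pmf measure_pmf.integrable_const_bound[where B = 1] simp: indicator_def)
  then show ?thesis
    using prob_disagree[OF n, of x ?z] by simp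
qed

text \<open>Distinct words of \<open>A\<close> agree at a random position with probability at most
  \<open>1 - \<delta>\<close> by \<open>hdist_gt\<close>; a union bound over ordered pairs gives the
  square.\<close>

lemma prob_separates:
  assumes "set zs \<subseteq> A"
  shows "measure_pmf.prob (replicate_pmf k (pmf_of_set {..<n})) {I. inj_on (\<lambda>z. map (\<lambda>i. z ! i) I) (set zs)}
    \<ge> 1 - real (length zs) ^ 2 * (1 - \<delta>) ^ k"
proof -
  let ?R = "replicate_pmf k (pmf_of_set {..<n})"
  let ?Z = "{(x, y). x \<in> set zs \<and> y \<in> set zs \<and> x \<noteq> y}"
  let ?E = "\<lambda>(x, y). {I. set I \<subseteq> {i. x ! i = y ! i}}"
  have Z: "?Z \<subseteq> set zs \<times> set zs" by auto
  then have fin: "finite ?Z" by (rule finite_subset) simp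
  have "card ?Z \<le> card (set zs \<times> set zs)"
    using Z by (intro card_mono) auto
  also have "\<dots> \<le> length zs ^ 2"
    by (simp add: card_cartesian_product power2_eq_square mult_mono card_length)
  finally have card: "real (card ?Z) \<le> real (length zs) ^ 2"
    by (simp only: of_nat_le_iff flip: of_nat_power)
  let ?G = "{I. inj_on (\<lambda>z. map (\<lambda>i. z ! i) I) (set zs)}"
  have "measure_pmf.prob ?R (UNIV - ?G) \<le> measure_pmf.prob ?R (\<Union>p\<in>?Z. ?E p)"
    by (rule measure_pmf.finite_measure_mono) (auto simp: inj_on_def)
  also have "\<dots> \<le> (\<Sum>p\<in>?Z. measure_pmf.prob ?R (?E p))"
    by (rule measure_pmf.finite_measure_subadditive_finite[OF fin]) auto
  also have "\<dots> \<le> (\<Sum>p\<in>?Z. (1 - \<delta>) ^ k)"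
  proof (rule sum_mono, clarify)
    fix x y assume "x \<in> set zs" "y \<in> set zs" "x \<noteq> y"
    then have "\<delta> < hdist n x y"
      using assms by (intro hdist_gt) auto
    then have "measure_pmf.prob (pmf_of_set {..<n}) {i. x ! i = y ! i} ^ k \<le> (1 - \<delta>) ^ k"
      by (intro power_mono) (auto simp: prob_agree[OF n] hdist_le_1)
    then show "measure_pmf.prob ?R {I. set I \<subseteq> {i. x ! i = y ! i}} \<le> (1 - \<delta>) ^ k"
      using prob_replicate_pmf_subset_le order_trans by blast
  qed
  also have "\<dots> \<le> real (length zs) ^ 2 * (1 - \<delta>) ^ k"
    using card \<delta> by (simp add: mult_right_mono)
  finally show ?thesis
    using measure_pmf.prob_compl[of ?G ?R] by simp
qed


text \<open>The corrected words are never read in full. Any strings of length \<open>n\<close> with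
  the collision pattern of the fingerprints replace them, since \<open>T'\<close> is to be applied
  only when it depends on the pattern alone.\<close>

definition decide :: "(bool list list \<Rightarrow> bool pmf) \<Rightarrow> bool list option list \<Rightarrow> bool pmf" where
  "decide T' rs =
     (if None \<in> set rs then return_pmf False
      else T' (SOME zs. set zs \<subseteq> strings n \<and> same_pattern zs (map the rs)))"

definition tester :: "nat \<Rightarrow> nat \<Rightarrow> nat \<Rightarrow> (bool list list \<Rightarrow> bool pmf) \<Rightarrow> (nat \<times> nat, bool) machine" where
  "tester m k r T' =
     bind_pmf (replicate_pmf k (pmf_of_set {..<n})) (\<lambda>I.
     mbind (mseq (map (\<lambda>j. mreindex (Pair j) (sample_machine r I)) [0..<m])) (\<lambda>rs.
     mlift (decide T' rs)))"

lemma set_pmf_indices: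
  "I \<in> set_pmf (replicate_pmf k (pmf_of_set {..<n})) \<Longrightarrow> set I \<subseteq> {..<n} \<and> length I = k"
  by (auto simp: set_replicate_pmf set_pmf_index)

lemma query_bounded_tester:
  "query_bounded (tester m k r T') ({..<m} \<times> {..<n})
     (real m * (2 * real r * b\<^sub>T + (2 * real r * b\<^sub>C + (1 + real k * (2 * real r * b\<^sub>C)))))"
proof -
  let ?b = "2 * real r * b\<^sub>T + (2 * real r * b\<^sub>C + (1 + (real k * (2 * real r * b\<^sub>C) + 0)))"
  have "query_bounded (tester m k r T') ({..<m} \<times> {..<n}) (real (length [0..<m]) * ?b + 0)"
    unfolding tester_def
  proof (intro query_bounded_bind_pmf query_bounded_mbind query_bounded_mlift)
    fix I assume "I \<in> set_pmf (replicate_pmf k (pmf_of_set {..<n}))"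
    then have I: "set I \<subseteq> {..<n}" "length I = k"
      using set_pmf_indices by auto
    have "query_bounded (mseq (map (\<lambda>j. mreindex (Pair j) (sample_machine r I)) [0..<m]))
      ({..<m} \<times> {..<n}) (real (length (map (\<lambda>j. mreindex (Pair j) (sample_machine r I)) [0..<m])) * ?b)"
    proof (rule query_bounded_mseq)
      fix M assume "M \<in> set (map (\<lambda>j. mreindex (Pair j) (sample_machine r I)) [0..<m])"
      then obtain j where "j < m" "M = mreindex (Pair j) (sample_machine r I)" by auto
      then show "query_bounded M ({..<m} \<times> {..<n}) ?b"
        using query_bounded_sample_machine[OF I(1), of r] I(2)
        by (auto intro: query_bounded_mreindex)
    qed
    then show "query_bounded (mseq (map (\<lambda>j. mreindex (Pair j) (sample_machine r I)) [0..<m]))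
      ({..<m} \<times> {..<n}) (real (length [0..<m]) * ?b)"
      by simp
  qed
  then show ?thesis by simp
qed

section \<open>Error analysis of the whole tester\<close>

definition run_tester ::
  "nat \<Rightarrow> nat \<Rightarrow> (bool list list \<Rightarrow> bool pmf) \<Rightarrow> bool list list \<Rightarrow> bool pmf" where
  "run_tester k r T' xs = bind_pmf (replicate_pmf k (pmf_of_set {..<n})) (\<lambda>I.
     bind_pmf (seq_pmf (map (sample_output r I) xs)) (decide T'))"

lemma doho_output_tester:
  "doho_output (tester m k r T') m P = bind_pmf (replicate_pmf m P) (run_tester k r T')"
  unfolding doho_output_def
proof (rule bind_pmf_cong[OF refl])
  fix xs assume "xs \<in> set_pmf (replicate_pmf m P)"
  then have "length xs = m"
    by (simp add: set_replicate_pmf)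
  then have "map (\<lambda>j. sample_output r I (xs ! j)) [0..<m] = map (sample_output r I) xs" for I
    using arg_cong[OF map_nth[of xs], of "map (sample_output r I)"] by (simp add: comp_def)
  then show "machine_output (tester m k r T') (\<lambda>(j, i). xs ! j ! i) = run_tester k r T' xs"
    by (simp add: tester_def run_tester_def machine_output_bind_pmf machine_output_mbind
        machine_output_mlift machine_output_mseq machine_output_mreindex comp_def flip: sample_output_def)
qed

text \<open>Covers completeness (\<kappa> the identity, \<open>N\<close> empty) and soundness
  (\<kappa> the correction, \<open>N = {None}\<close>). Unless some outcome is wrong or the
  fingerprints collide, the verdict is that of \<open>T'\<close> on the words
  \<open>\<kappa> x\<close>, or a rejection caused by a failure.\<close>

lemma run_tester_ge:
  assumes T': "\<And>xs ys. same_pattern xs ys \<Longrightarrow> set xs \<subseteq> strings n \<Longrightarrow> set ys \<subseteq> strings n \<Longrightarrow> T' xs = T' ys"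
    and \<kappa>: "\<And>x. x \<in> set xs \<Longrightarrow> \<kappa> x \<in> A"
    and N: "N \<subseteq> {None}" "N = {} \<or> \<not> b"
    and G: "\<And>I x. set I \<subseteq> {..<n} \<Longrightarrow> length I = k \<Longrightarrow> x \<in> set xs \<Longrightarrow>
      measure_pmf.prob (sample_output r I x) (insert (Some (map (\<lambda>i. \<kappa> x ! i) I)) N) \<ge> 1 - a"
  shows "measure_pmf.prob (run_tester k r T' xs) {b} \<ge>
    measure_pmf.prob (T' (map \<kappa> xs)) {b} - (real (length xs) * a + real (length xs) ^ 2 * (1 - \<delta>) ^ k)"
proof -
  let ?v = "measure_pmf.prob (T' (map \<kappa> xs)) {b}"
  let ?zs = "map \<kappa> xs"
  have zs: "set ?zs \<subseteq> A" using \<kappa> by auto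
  have "?v - real (length xs) * a - real (length xs) ^ 2 * (1 - \<delta>) ^ k \<le>
    measure_pmf.prob (run_tester k r T' xs) {b}"
    unfolding run_tester_def
  proof (rule prob_bind_pmf_ge)
    show "1 - real (length xs) ^ 2 * (1 - \<delta>) ^ k \<le> measure_pmf.prob (replicate_pmf k (pmf_of_set {..<n}))
       {I. inj_on (\<lambda>z. map (\<lambda>i. z ! i) I) (set ?zs)}"
      using prob_separates[OF zs] by simp
  next
    fix I assume I: "I \<in> set_pmf (replicate_pmf k (pmf_of_set {..<n}))"
      and inj: "I \<in> {I. inj_on (\<lambda>z. map (\<lambda>i. z ! i) I) (set ?zs)}"
    let ?fp = "\<lambda>z. map (\<lambda>i. z ! i) I"
    let ?G = "\<lambda>x. insert (Some (?fp (\<kappa> x))) N"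
    show "?v - real (length xs) * a \<le> measure_pmf.prob
      (bind_pmf (seq_pmf (map (sample_output r I) xs)) (decide T')) {b}"
    proof (rule prob_bind_pmf_ge)
      show "1 - real (length xs) * a \<le> measure_pmf.prob (seq_pmf (map (sample_output r I) xs))
         {rs. list_all2 (\<lambda>x r. r \<in> ?G x) xs rs}"
        using set_pmf_indices[OF I] by (intro prob_seq_pmf_ge G) auto
    next
      fix rs assume "rs \<in> {rs. list_all2 (\<lambda>x r. r \<in> ?G x) xs rs}"
      then have rs: "list_all2 (\<lambda>x r. r \<in> ?G x) xs rs" by simp
      show "?v \<le> measure_pmf.prob (decide T' rs) {b}"
      proof (cases "None \<in> set rs")
        case True
        \<comment> \<open>Failures can occur only for \<open>N = {None}\<close>, where
          \<open>b\<close> is False and rejection is the wanted verdict.\<close>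
        then obtain x where "None \<in> ?G x"
          using rs by (auto simp: list_all2_conv_all_nth in_set_conv_nth)
        then have "\<not> b" using N by auto
        then show ?thesis
          using True by (simp add: decide_def)
      next
        case False
        have "rs = map (\<lambda>x. Some (?fp (\<kappa> x))) xs"
        proof (rule nth_equalityI)
          show "length rs = length (map (\<lambda>x. Some (?fp (\<kappa> x))) xs)"
            using rs by (simp add: list_all2_lengthD)
          fix j assume j: "j < length rs"
          have "rs ! j \<in> ?G (xs ! j)"
            using rs j by (simp add: list_all2_conv_all_nth)
          moreover have "rs ! j \<noteq> None"
            using False nth_mem[OF j] by metis
          ultimately show "rs ! j = map (\<lambda>x. Some (?fp (\<kappa> x))) xs ! j"
            using N(1) j list_all2_lengthD[OF rs] by auto
        qed
        then have eq: "map the rs = map ?fp ?zs"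
          by (simp add: comp_def)
        let ?w = "SOME zs. set zs \<subseteq> strings n \<and> same_pattern zs (map the rs)"
        have pat: "same_pattern ?zs (map the rs)"
          unfolding eq using inj by (intro same_pattern_map) simp
        \<comment> \<open>The true words witness the \<open>SOME\<close> in \<open>decide\<close>;
          the strings it picks may differ from them but share their pattern.\<close>
        have "set ?zs \<subseteq> strings n \<and> same_pattern ?zs (map the rs)"
          using zs A(1) pat by auto
        then have "set ?w \<subseteq> strings n \<and> same_pattern ?w (map the rs)"
          by (rule someI)
        moreover from this have "same_pattern ?w ?zs"
          using pat same_pattern_trans same_pattern_commute by blast
        ultimately have "T' ?w = T' ?zs"
          using zs A(1) by (intro T') auto
        then show ?thesis
          using False by (simp add: decide_def)
      qed
    qed simp
  next
    \<comment> \<open>\<open>G\<close> speaks only of members of \<open>xs\<close>, so the sign of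
      \<open>a\<close> follows only for nonempty \<open>xs\<close>; otherwise the product below is
      0.\<close>
    have "0 \<le> a" if "xs \<noteq> []"
    proof -
      obtain I where "I \<in> set_pmf (replicate_pmf k (pmf_of_set {..<n}))"
        using set_pmf_not_empty by fast
      then have I: "set I \<subseteq> {..<n}" "length I = k"
        using set_pmf_indices by auto
      then show ?thesis
        using order_trans[OF G[OF I, of "hd xs"] measure_pmf.prob_le_1] that by simp
    qed
    then have "0 \<le> real (length xs) * a"
      by (cases "xs = []") auto
    moreover have "?v \<le> 1"
      by (rule measure_pmf.prob_le_1)
    ultimately show "?v - real (length xs) * a \<le> 1"
      by linarith
  qed
  then show ?thesis by simp
qed

lemma tester_complete:
  assumes T': "\<And>xs ys. same_pattern xs ys \<Longrightarrow> set xs \<subseteq> strings n \<Longrightarrow> set ys \<subseteq> strings n \<Longrightarrow> T' xs = T' ys"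
    and P: "set_pmf P \<subseteq> A"
  shows "pmf (doho_output (tester m k r T') m P) True \<ge> pmf (bind_pmf (replicate_pmf m P) T') True -
    (real m * ((real k + 2) * (8/9) ^ r) + real m ^ 2 * (1 - \<delta>) ^ k)"
  unfolding doho_output_tester measure_pmf_single[symmetric]
proof (rule prob_bind_pmf_mono)
  fix xs assume "xs \<in> set_pmf (replicate_pmf m P)"
  then have xs: "set xs \<subseteq> A" "length xs = m"
    using P by (auto simp: set_replicate_pmf)
  have "measure_pmf.prob (run_tester k r T' xs) {True} \<ge> measure_pmf.prob (T' (map (\<lambda>x. x) xs)) {True} -
      (real (length xs) * ((real k + 2) * (8/9) ^ r) + real (length xs) ^ 2 * (1 - \<delta>) ^ k)"
    by (rule run_tester_ge[where N = "{}"]) (use xs T' sample_output_complete in auto)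
  then show "measure_pmf.prob (T' xs) {True} -
      (real m * ((real k + 2) * (8/9) ^ r) + real m ^ 2 * (1 - \<delta>) ^ k)
      \<le> measure_pmf.prob (run_tester k r T' xs) {True}"
    using xs by simp
qed

lemma tester_sound_corrected:
  assumes T': "\<And>xs ys. same_pattern xs ys \<Longrightarrow> set xs \<subseteq> strings n \<Longrightarrow> set ys \<subseteq> strings n \<Longrightarrow> T' xs = T' ys"
    and P: "P \<in> dists n"
  shows "pmf (doho_output (tester m k r T') m P) False \<ge>
    pmf (bind_pmf (replicate_pmf m (map_pmf correct P)) T') False -
    (real m * ((real k + 2) * (8/9) ^ r) + real m ^ 2 * (1 - \<delta>) ^ k)"
  unfolding doho_output_tester measure_pmf_single[symmetric] map_replicate_pmf[symmetric] bind_map_pmf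
proof (rule prob_bind_pmf_mono)
  fix xs assume "xs \<in> set_pmf (replicate_pmf m P)"
  then have xs: "set xs \<subseteq> strings n" "length xs = m"
    using P by (auto simp: set_replicate_pmf dists_def)
  have "measure_pmf.prob (run_tester k r T' xs) {False} \<ge> measure_pmf.prob (T' (map correct xs)) {False} -
      (real (length xs) * ((real k + 2) * (8/9) ^ r) + real (length xs) ^ 2 * (1 - \<delta>) ^ k)"
    by (rule run_tester_ge[where N = "{None}"]) (use xs T' sample_output_sound correct_in in auto)
  then show "measure_pmf.prob (T' (map correct xs)) {False} -
      (real m * ((real k + 2) * (8/9) ^ r) + real m ^ 2 * (1 - \<delta>) ^ k)
      \<le> measure_pmf.prob (run_tester k r T' xs) {False}"
    using xs by simp
qed

text \<open>By \<open>sample_output_None\<close> each sample is rejected with probability at least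
  \<open>\<epsilon> / 4\<close>, and \<open>m \<ge> 8 / \<epsilon>\<close> samples all pass with
  probability at most exp (-2) \<le> 1/3.\<close>

lemma tester_sound_distance:
  assumes P: "P \<in> dists n" and r: "(8/9) ^ r \<le> (1/2 :: real)"
    and dist: "\<epsilon> / 2 \<le> measure_pmf.expectation P (\<lambda>x. hdist n x (correct x))"
    and m: "8 \<le> real m * \<epsilon>"
  shows "pmf (doho_output (tester m k r T') m P) False \<ge> 2/3"
proof -
  have fin: "finite (set_pmf P)"
    using P finite_subset[OF _ finite_strings] by (auto simp: dists_def)
  have reject: "2/3 \<le> measure_pmf.prob (bind_pmf (replicate_pmf m (bind_pmf P (sample_output r I))) (decide T')) {False}"
    for I
  proof -
    let ?q = "bind_pmf P (sample_output r I)"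
    have "\<epsilon> / 4 \<le> measure_pmf.expectation P (\<lambda>x. hdist n x (correct x) / 2)"
      using dist by simp
    also have "\<dots> \<le> measure_pmf.expectation P (\<lambda>x. measure_pmf.prob (sample_output r I x) {None})"
    proof (rule integral_mono_AE)
      show "AE x in measure_pmf P. hdist n x (correct x) / 2 \<le> measure_pmf.prob (sample_output r I x) {None}"
        using P sample_output_None[OF _ r] by (auto simp: AE_measure_pmf_iff dists_def)
    qed (auto intro: integrable_measure_pmf_finite fin integrable_prob_pmf)
    finally have q: "\<epsilon> / 4 \<le> measure_pmf.prob ?q {None}"
      by (simp add: prob_bind_pmf)
    have "UNIV - {None} = - {None :: bool list option}" by auto
    then have "measure_pmf.prob ?q (- {None}) \<le> 1 - \<epsilon> / 4"
      using q measure_pmf.prob_compl[of "{None}" ?q] by simp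
    also have "\<dots> \<le> exp (- \<epsilon> / 4)"
      using exp_ge_add_one_self[of "- \<epsilon> / 4"] by simp
    finally have "measure_pmf.prob ?q (- {None}) ^ m \<le> exp (- \<epsilon> / 4) ^ m"
      by (rule power_mono) simp
    also have "\<dots> = exp (- (real m * \<epsilon> / 4))"
      by (simp flip: exp_of_nat_mult)
    also have "\<dots> \<le> exp (- 2)"
      using m by simp
    also have "\<dots> \<le> 1 / (3 :: real)"
      using exp_ge_add_one_self[of "2 :: real"] by (simp add: exp_minus field_simps)
    finally have "measure_pmf.prob ?q (- {None}) ^ m \<le> 1/3" .
    then have le: "measure_pmf.prob (replicate_pmf m ?q) {rs. set rs \<subseteq> - {None}} \<le> 1/3"
      using prob_replicate_pmf_subset_le[of m ?q "- {None}"] by linarith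
    have eq: "UNIV - {rs. set rs \<subseteq> - {None}} = {rs. None \<in> set rs}" by auto
    have "1 - 1/3 \<le> measure_pmf.prob (replicate_pmf m ?q) (UNIV - {rs. set rs \<subseteq> - {None}})"
      using le measure_pmf.prob_compl[of "{rs. set rs \<subseteq> - {None}}" "replicate_pmf m ?q"] by simp
    then have "1 - 1/3 \<le> measure_pmf.prob (replicate_pmf m ?q) {rs. None \<in> set rs}"
      by (simp only: eq)
    then have "1 - 1/3 \<le> measure_pmf.prob (bind_pmf (replicate_pmf m ?q) (decide T')) {False}"
      by (rule prob_bind_pmf_ge) (auto simp: decide_def)
    then show ?thesis by simp
  qed
  \<comment> \<open>The positions are drawn before the samples, because the outcomes are independent
    only once \<open>I\<close> is fixed.\<close>
  have "doho_output (tester m k r T') m P = bind_pmf (replicate_pmf k (pmf_of_set {..<n})) (\<lambda>I.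
      bind_pmf (bind_pmf (replicate_pmf m P) (\<lambda>xs. seq_pmf (map (sample_output r I) xs))) (decide T'))"
    unfolding doho_output_tester run_tester_def by (subst bind_commute_pmf) (simp add: bind_assoc_pmf)
  also have "\<dots> = bind_pmf (replicate_pmf k (pmf_of_set {..<n})) (\<lambda>I.
      bind_pmf (replicate_pmf m (bind_pmf P (sample_output r I))) (decide T'))"
    by (simp add: bind_replicate_pmf_seq_pmf)
  finally have eq: "doho_output (tester m k r T') m P = \<dots>" .
  have "2/3 - 0 \<le> measure_pmf.prob (doho_output (tester m k r T') m P) {False}"
    unfolding eq by (rule prob_bind_pmf_ge[where A = UNIV]) (use reject in auto)
  then show ?thesis
    by (simp add: measure_pmf_single)
qed

text \<open>Without queries the string tester cannot reject, so the complement of a word of \<open>A\<close> is within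
  \<open>\<delta> < 1\<close> of a word of \<open>A\<close>, which is a second word; but a blind corrector knows only one.\<close>

lemma one_le_queries: "1 \<le> b\<^sub>T + b\<^sub>C"
proof (rule ccontr)
  assume less: "\<not> 1 \<le> b\<^sub>T + b\<^sub>C"
  have nonneg: "0 \<le> b\<^sub>T" "0 \<le> b\<^sub>C"
    using query_bounded_nonneg T_bounded C_bounded[of 0] n by auto
  have blind: "machine_output M f = machine_output M g" if "query_bounded M I b" "b < 1"
    for M :: "(nat, 'b) machine" and I b f g
    unfolding machine_output_def
  proof (rule map_pmf_cong[OF refl])
    fix t assume "t \<in> set_pmf M"
    then have "depth t = 0"
      using that by (fastforce simp: query_bounded_def)
    then show "run t f = run t g"
      by (cases t) auto
  qed
  obtain x where x: "x \<in> A" using A(2) by auto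
  then have xs: "length x = n" using A(1) by (auto simp: strings_def)
  let ?y = "map Not x"
  have y: "?y \<in> strings n" using xs by (simp add: strings_def)
  have "pmf (machine_output T (\<lambda>i. ?y ! i)) True \<ge> 2/3"
    using T_complete[OF x] blind[OF T_bounded, of "\<lambda>i. x ! i" "\<lambda>i. ?y ! i"] less nonneg by simp
  then have "\<not> pmf (machine_output T (\<lambda>i. ?y ! i)) False \<ge> 2/3"
    by (simp add: pmf_False_conv_True)
  then have "\<not> far_from n \<delta> ?y A"
    using T_sound[OF y] by blast
  then obtain z where z: "z \<in> A" "hdist n ?y z \<le> \<delta>"
    by (auto simp: far_from_def not_less)
  have "\<exists>i<n. z ! i \<noteq> x ! i"
  proof (rule ccontr)
    assume "\<not> (\<exists>i<n. z ! i \<noteq> x ! i)"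
    then have "{i. i < n \<and> ?y ! i \<noteq> z ! i} = {..<n}"
      using xs by auto
    then have "hdist n ?y z = 1"
      using n by (simp add: hdist_def)
    then show False using z(2) \<delta>(2) by simp
  qed
  then obtain i where i: "i < n" "z ! i \<noteq> x ! i" by auto
  let ?M = "machine_output (C i) (\<lambda>j. x ! j)"
  have "?M = machine_output (C i) (\<lambda>j. z ! j)"
    using less nonneg by (intro blind[OF C_bounded[OF i(1)]]) simp
  then have "4/3 \<le> measure_pmf.prob ?M {Some (x ! i)} + measure_pmf.prob ?M {Some (z ! i)}"
    using C_complete[OF i(1) x] C_complete[OF i(1) z(1)] by (simp add: measure_pmf_single)
  also have "\<dots> = measure_pmf.prob ?M ({Some (x ! i)} \<union> {Some (z ! i)})"
    by (rule measure_pmf.finite_measure_Union[symmetric]) (use i in auto)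
  also have "\<dots> \<le> 1" by (rule measure_pmf.prob_le_1)
  finally show False by simp
qed

end

text \<open>Soundness splits on the corrected distribution. If it is far from \<open>E\<close>, the
  simulated tester rejects with probability 9/10 - 1/10; otherwise \<open>emd_far_cases\<close>
  makes the average correction distance large and the samples themselves cause rejection.\<close>

lemma (in self_correcting_property) doho_tester:
  assumes E: "label_invariant n E" "E \<subseteq> dists n" "\<And>R. R \<in> E \<Longrightarrow> card (set_pmf R) \<le> card A"
    and T': "\<And>P. P \<in> dists n \<Longrightarrow> P \<in> E \<Longrightarrow> pmf (bind_pmf (replicate_pmf m P) T') True \<ge> 9/10"
      "\<And>P. P \<in> dists n \<Longrightarrow> tv_far n (\<epsilon>' / 2) P E \<Longrightarrow>
        pmf (bind_pmf (replicate_pmf m P) T') False \<ge> 9/10"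
      "\<And>xs ys. same_pattern xs ys \<Longrightarrow> set xs \<subseteq> strings n \<Longrightarrow> set ys \<subseteq> strings n \<Longrightarrow> T' xs = T' ys"
    and r: "(8/9) ^ r \<le> (1/2 :: real)"
    and err: "real m * ((real k + 2) * (8/9) ^ r) + real m ^ 2 * (1 - \<delta>) ^ k \<le> 1/10"
    and m: "8 \<le> real m * \<epsilon>'" and le: "\<epsilon>' \<le> \<epsilon>"
    and P: "P \<in> dists n"
  shows "P \<in> {R \<in> E. set_pmf R \<subseteq> A} \<Longrightarrow> pmf (doho_output (tester m k r T') m P) True \<ge> 2/3"
    and "emd_far n \<epsilon> P {R \<in> E. set_pmf R \<subseteq> A} \<Longrightarrow>
      pmf (doho_output (tester m k r T') m P) False \<ge> 2/3"
proof -
  show "pmf (doho_output (tester m k r T') m P) True \<ge> 2/3" if "P \<in> {R \<in> E. set_pmf R \<subseteq> A}"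
    using tester_complete[OF T'(3), where P = P and k = k and r = r and m = m] T'(1)[OF P] err that by fastforce
  show "pmf (doho_output (tester m k r T') m P) False \<ge> 2/3"
    if far: "emd_far n \<epsilon> P {R \<in> E. set_pmf R \<subseteq> A}"
  proof (cases "tv_far n (\<epsilon>' / 2) (map_pmf correct P) E")
    case True
    have "map_pmf correct P \<in> dists n"
      using correct_in A(1) by (auto simp: dists_def)
    then show ?thesis
      using tester_sound_corrected[OF T'(3) P, where k = k and r = r and m = m] T'(2)[OF _ True] err by fastforce
  next
    case False
    have "\<epsilon>' / 2 < measure_pmf.expectation P (\<lambda>x. hdist n x (correct x))"
      by (rule emd_far_cases[OF E(1,2) A(1) E(3) P correct_in far False le])
    then show ?thesis
      by (intro tester_sound_distance[OF P r _ m]) simp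
  qed
qed

text \<open>The number of fingerprint positions is \<open>k = O(ln S / \<delta>)\<close> and the amplification is
  \<open>r = O(ln S)\<close>; the hypothesis \<open>1 / \<delta> \<le> d * S\<close> is what makes \<open>ln k = O(ln S)\<close>.\<close>

lemma tester_parameters:
  fixes d :: real and R :: nat
  assumes d: "0 \<le> d"
  obtains K :: real where "0 \<le> K"
    "\<And>(S :: nat) \<delta>. 1 \<le> S \<Longrightarrow> 0 < \<delta> \<Longrightarrow> \<delta> < 1 \<Longrightarrow> 1 / \<delta> \<le> d * real S \<Longrightarrow>
      \<exists>k r. (8/9) ^ r \<le> (1/2 :: real) \<and>
        real (R * S) * ((real k + 2) * (8/9) ^ r) + real (R * S) ^ 2 * (1 - \<delta>) ^ k \<le> 1/10 \<and>
        (\<forall>b\<^sub>T b\<^sub>C. 0 \<le> b\<^sub>T \<longrightarrow> 0 \<le> b\<^sub>C \<longrightarrow> 1 \<le> b\<^sub>T + b\<^sub>C \<longrightarrow>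
          real (R * S) * (2 * real r * b\<^sub>T + (2 * real r * b\<^sub>C + (1 + real k * (2 * real r * b\<^sub>C))))
            \<le> K * (real S * ln (real S + 2) ^ 2) * ((b\<^sub>T + b\<^sub>C) / \<delta>))"
proof -
  \<comment> \<open>As \<open>X\<close> is at least 3, this brings
    \<open>R ^ 2 / X ^ \<beta>\<close> below 1/20. The 2 added in \<alpha> pays for the
    \<open>S ^ 2\<close> in the count of pairs.\<close>
  obtain \<beta> :: nat where \<beta>: "20 * real R ^ 2 < 3 ^ \<beta>"
    using real_arch_pow[of "3 :: real" "20 * real R ^ 2"] by auto
  define \<alpha> where "\<alpha> = 2 + \<beta>"
  \<comment> \<open>The other 1/20. The 3 added in \<open>g\<close> pays for one factor
    \<open>X\<close> from the number of samples and \<open>X ^ 2\<close> from the bound on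
    \<open>k + 2\<close>.\<close>
  obtain h :: nat where h: "20 * real R * (real \<alpha> * d + 3) < 3 ^ h"
    using real_arch_pow[of "3 :: real" "20 * real R * (real \<alpha> * d + 3)"] by auto
  define g where "g = 3 + h"
  define \<rho> where "\<rho> = 2 * (9 * real g + 1)"
  define K where "K = real R * (\<rho> + 1 + (real \<alpha> + 1) * \<rho>)"
  show thesis
  proof
    show "0 \<le> K" by (simp add: K_def \<rho>_def)
    fix S :: nat and \<delta> :: real
    assume S: "1 \<le> S" and \<delta>: "0 < \<delta>" "\<delta> < 1" "1 / \<delta> \<le> d * real S"
    define l where "l = ln (real S + 2)"
    define X where "X = real S + 2"
    have X: "3 \<le> X" "real S \<le> X" using S by (simp_all add: X_def)
    have expl: "exp (real j * l) = X ^ j" for j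
      using X by (simp add: exp_of_nat_mult l_def X_def)
    have "exp 1 \<le> X" using exp_le X(1) by linarith
    then have l1: "1 \<le> l"
      using X ln_ge_iff[of X 1] by (simp add: l_def X_def)
    have lX: "l \<le> X"
      using ln_le_minus_one[of X] X by (simp add: l_def X_def)
    define k where "k = nat \<lceil>real \<alpha> * l / \<delta>\<rceil>"
    \<comment> \<open>The factor 9 comes from 8/9 \<le> exp (-1/9).\<close>
    define r where "r = nat \<lceil>9 * real g * l\<rceil>"
    have k: "real \<alpha> * l / \<delta> \<le> real k" "real k \<le> real \<alpha> * l / \<delta> + 1"
      unfolding k_def using l1 \<delta> by (auto simp: of_nat_ceiling ceiling_le_iff)
    have r: "9 * real g * l \<le> real r" "real r \<le> 9 * real g * l + 1"
      unfolding r_def using l1 by (auto simp: of_nat_ceiling)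
    have "(1 - \<delta>) ^ k \<le> exp (- \<delta>) ^ k"
      using \<delta> exp_ge_add_one_self[of "- \<delta>"] by (intro power_mono) auto
    also have "\<dots> = exp (- (\<delta> * real k))"
      by (simp add: mult.commute flip: exp_of_nat_mult)
    also have "\<dots> \<le> exp (- (real \<alpha> * l))"
      using k(1) \<delta> by (simp add: field_simps)
    also have "\<dots> = 1 / X ^ \<alpha>"
      by (simp add: exp_minus expl inverse_eq_divide)
    finally have sep: "(1 - \<delta>) ^ k \<le> 1 / X ^ \<alpha>" .
    have "(8/9 :: real) ^ r \<le> exp (- 1/9) ^ r"
      using exp_ge_add_one_self[of "- 1/9 :: real"] by (intro power_mono) auto
    also have "\<dots> = exp (- (real r / 9))"
      by (simp flip: exp_of_nat_mult)
    also have "\<dots> \<le> exp (- (real g * l))"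
      using r(1) by simp
    also have "\<dots> = 1 / X ^ g"
      by (simp add: exp_minus expl inverse_eq_divide)
    finally have amp: "(8/9) ^ r \<le> 1 / X ^ g" .
    have pow3: "3 ^ j \<le> X ^ j" for j
      using X by (intro power_mono) auto
    have r2: "(8/9) ^ r \<le> (1/2 :: real)"
    proof -
      have "1 / X ^ g \<le> 1 / X ^ 1"
        using X by (intro divide_left_mono power_increasing) (auto simp: g_def)
      also have "\<dots> \<le> 1/2" using X by (simp add: field_simps)
      finally show ?thesis using amp by linarith
    qed
    have "real (R * S) ^ 2 * (1 - \<delta>) ^ k \<le> (real R ^ 2 * X ^ 2) * (1 / X ^ \<alpha>)"
      using sep X \<delta> by (intro mult_mono) (auto simp: power_mult_distrib intro!: mult_left_mono power_mono)
    also have "\<dots> = real R ^ 2 / X ^ \<beta>"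
      using X by (simp add: \<alpha>_def power_add power2_eq_square)
    also have "\<dots> \<le> real R ^ 2 / 3 ^ \<beta>"
      using pow3 X by (intro divide_left_mono) auto
    also have "\<dots> \<le> 1/20"
      using \<beta> by (simp add: field_simps)
    finally have err1: "real (R * S) ^ 2 * (1 - \<delta>) ^ k \<le> 1/20" .
    have "real \<alpha> * l / \<delta> = real \<alpha> * (l * (1 / \<delta>))" by simp
    also have "\<dots> \<le> real \<alpha> * (X * (d * X))"
      using lX \<delta> X d l1
      by (intro mult_left_mono mult_mono order_trans[OF \<delta>(3)]) auto
    finally have "real k + 2 \<le> real \<alpha> * (X * (d * X)) + 3 * 1"
      using k(2) by linarith
    also have "\<dots> \<le> real \<alpha> * (X * (d * X)) + 3 * X ^ 2"
      using X by (intro add_left_mono mult_left_mono one_le_power) auto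
    also have "\<dots> = (real \<alpha> * d + 3) * X ^ 2"
      by (simp add: algebra_simps power2_eq_square)
    finally have k2: "real k + 2 \<le> (real \<alpha> * d + 3) * X ^ 2" .
    have "real (R * S) * ((real k + 2) * (8/9) ^ r) \<le> (real R * X) * (((real \<alpha> * d + 3) * X ^ 2) * (1 / X ^ g))"
      using k2 amp X d by (intro mult_mono) (auto intro: mult_left_mono)
    also have "\<dots> = real R * (real \<alpha> * d + 3) / X ^ h"
      using X by (simp add: g_def power_add power2_eq_square power3_eq_cube)
    also have "\<dots> \<le> real R * (real \<alpha> * d + 3) / 3 ^ h"
      using pow3 X d by (intro divide_left_mono) auto
    also have "\<dots> \<le> 1/20"
      using h by (simp add: field_simps)
    finally have err2: "real (R * S) * ((real k + 2) * (8/9) ^ r) \<le> 1/20" .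
    have "real (R * S) * (2 * real r * b\<^sub>T + (2 * real r * b\<^sub>C + (1 + real k * (2 * real r * b\<^sub>C))))
            \<le> K * (real S * l ^ 2) * ((b\<^sub>T + b\<^sub>C) / \<delta>)"
      if b: "0 \<le> b\<^sub>T" "0 \<le> b\<^sub>C" "1 \<le> b\<^sub>T + b\<^sub>C" for b\<^sub>T b\<^sub>C
    proof -
      \<comment> \<open>One logarithm stems from \<open>r\<close> and one from \<open>k\<close>;
        terms with fewer are rounded up using \<open>1 \<le> l\<close>.\<close>
      let ?u = "l ^ 2 * (b\<^sub>T + b\<^sub>C) / \<delta>"
      have \<rho>: "0 \<le> \<rho>" "2 * real r \<le> \<rho> * l"
        using r(2) l1 by (auto simp: \<rho>_def algebra_simps)
      have ll: "l \<le> l ^ 2" using l1 by (simp add: power2_eq_square)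
      have d1: "y \<le> y / \<delta>" if "0 \<le> y" for y
        using \<delta> that by (simp add: le_divide_eq mult_left_le)
      have lu: "l * (b\<^sub>T + b\<^sub>C) \<le> ?u"
        by (rule order_trans[OF mult_right_mono[OF ll] d1]) (use b in auto)
      have rb: "2 * real r * b \<le> \<rho> * l * b" if "0 \<le> b" for b
        using \<rho>(2) that by (rule mult_right_mono)
      have "2 * real r * b\<^sub>T + 2 * real r * b\<^sub>C \<le> \<rho> * (l * (b\<^sub>T + b\<^sub>C))"
        using rb[OF b(1)] rb[OF b(2)] by (simp add: algebra_simps)
      also have "\<dots> \<le> \<rho> * ?u"
        by (rule mult_left_mono[OF lu \<rho>(1)])
      finally have t1: "2 * real r * b\<^sub>T + 2 * real r * b\<^sub>C \<le> \<rho> * ?u" .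
      \<comment> \<open>The single direct query of the spot check is charged to the others;
        \<open>one_le_queries\<close> will supply
        \<open>1 \<le> b\<^sub>T + b\<^sub>C\<close>.\<close>
      have t2: "1 \<le> ?u"
        using lu mult_mono[OF l1 b(3)] l1 by simp
      have "real k \<le> real \<alpha> * l / \<delta> + l / \<delta>"
        using k(2) d1[of l] l1 by linarith
      then have "real k \<le> (real \<alpha> + 1) * l / \<delta>"
        by (simp add: distrib_right add_divide_distrib)
      then have "real k * (2 * real r * b\<^sub>C) \<le> ((real \<alpha> + 1) * l / \<delta>) * (\<rho> * l * (b\<^sub>T + b\<^sub>C))"
        using rb[OF b(2)] b \<rho> l1 \<delta>
        by (intro mult_mono order_trans[OF rb[OF b(2)]] mult_left_mono) auto
      also have "\<dots> = (real \<alpha> + 1) * \<rho> * ?u"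
        by (simp add: power2_eq_square)
      finally have t3: "real k * (2 * real r * b\<^sub>C) \<le> (real \<alpha> + 1) * \<rho> * ?u" .
      have "2 * real r * b\<^sub>T + (2 * real r * b\<^sub>C + (1 + real k * (2 * real r * b\<^sub>C))) \<le>
          (\<rho> + 1 + (real \<alpha> + 1) * \<rho>) * ?u"
        using t1 t2 t3 by (simp only: distrib_right mult_1)
      then have "real (R * S) * (2 * real r * b\<^sub>T + (2 * real r * b\<^sub>C + (1 + real k * (2 * real r * b\<^sub>C)))) \<le>
          real (R * S) * ((\<rho> + 1 + (real \<alpha> + 1) * \<rho>) * ?u)"
        by (rule mult_left_mono) simp
      then show ?thesis
        by (simp add: K_def mult_ac)
    qed
    with r2 err1 err2 show "\<exists>k r. (8/9) ^ r \<le> (1/2 :: real) \<and>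
        real (R * S) * ((real k + 2) * (8/9) ^ r) + real (R * S) ^ 2 * (1 - \<delta>) ^ k \<le> 1/10 \<and>
        (\<forall>b\<^sub>T b\<^sub>C. 0 \<le> b\<^sub>T \<longrightarrow> 0 \<le> b\<^sub>C \<longrightarrow> 1 \<le> b\<^sub>T + b\<^sub>C \<longrightarrow>
          real (R * S) * (2 * real r * b\<^sub>T + (2 * real r * b\<^sub>C + (1 + real k * (2 * real r * b\<^sub>C))))
            \<le> K * (real S * ln (real S + 2) ^ 2) * ((b\<^sub>T + b\<^sub>C) / \<delta>))"
      unfolding l_def by (intro exI[of _ k] exI[of _ r]) auto
  qed
qed

section \<open>Choice of constants and assembly\<close>

theorem theorem3p1:
  fixes D :: "nat \<Rightarrow> bool list pmf set"
    and L :: "nat \<Rightarrow> bool list set"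
    and s :: "nat \<Rightarrow> real \<Rightarrow> nat"
    and q\<^sub>T :: "nat \<Rightarrow> real \<Rightarrow> real"
    and q\<^sub>C \<delta> :: "nat \<Rightarrow> real"
    and c\<^sub>1 c\<^sub>2 :: real
  assumes "\<And>n. 1 \<le> n \<Longrightarrow> D n \<subseteq> dists n"
    and "\<And>n. 1 \<le> n \<Longrightarrow> label_invariant n (D n)"
    and "standard_testable D s"
    and "(\<lambda>(n, \<epsilon>). real (s n \<epsilon>)) \<in> \<Omega>[principal params](\<lambda>(n, \<epsilon>). 1 / \<epsilon>)"
    and "\<And>n. 1 \<le> n \<Longrightarrow> L n \<subseteq> strings n"
    and "string_testable L q\<^sub>T"
    and "\<And>n. 1 \<le> n \<Longrightarrow> 0 < \<delta> n \<and> \<delta> n < 1"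
    and "self_correctable L \<delta> q\<^sub>C"
    and "\<And>n P. 1 \<le> n \<Longrightarrow> P \<in> D n \<Longrightarrow> card (set_pmf P) \<le> card (L n)"
    and "0 < c\<^sub>1" and "0 < c\<^sub>2"
    and "\<And>n \<epsilon>. 1 \<le> n \<Longrightarrow> c\<^sub>1 / real n \<le> \<epsilon> \<Longrightarrow> \<epsilon> \<le> c\<^sub>2 \<Longrightarrow> q\<^sub>T n \<epsilon> \<ge> 2 * q\<^sub>T n (2 * \<epsilon>)"
  shows "\<exists>m \<sigma>.
     (\<lambda>(n, \<epsilon>). real (m n \<epsilon>)) \<in> O[principal params](\<lambda>(n, \<epsilon>). real (s n (min \<epsilon> (\<delta> n) / 2))) \<and>
     (\<lambda>(n, \<epsilon>). \<sigma> n \<epsilon>) \<in> soft_bigo (principal params) (\<lambda>(n, \<epsilon>). real (s n (min \<epsilon> (\<delta> n) / 2))) \<and>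
     doho_testable (\<lambda>n. {P \<in> D n. set_pmf P \<subseteq> L n}) m
       (\<lambda>n \<epsilon>. \<sigma> n \<epsilon> * ((q\<^sub>T n (\<delta> n) + q\<^sub>C n) / \<delta> n))"
proof -
  define S where "S n \<epsilon> = s n (min \<epsilon> (\<delta> n) / 2)" for n \<epsilon>
  have half: "(n, min \<epsilon> (\<delta> n) / 2) \<in> params" "(n, \<delta> n) \<in> params" if "(n, \<epsilon>) \<in> params" for n \<epsilon>
    using that assms(7)[of n] by (auto simp: params_def min_def)
  obtain c where c: "0 < c" "\<And>n \<epsilon>. (n, \<epsilon>) \<in> params \<Longrightarrow> c / \<epsilon> \<le> real (s n \<epsilon>)"
  proof -
    obtain c where "0 < c"
      "\<forall>\<^sub>F p in principal params. norm (case p of (n, \<epsilon>) \<Rightarrow> real (s n \<epsilon>)) \<ge> c * norm (case p of (n, \<epsilon>) \<Rightarrow> 1 / \<epsilon>)"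
      using landau_omega.bigE[OF assms(4)] by auto
    then show thesis
      by (intro that[of c]) (auto simp: eventually_principal params_def abs_if split: prod.splits if_splits)
  qed
  \<comment> \<open>All three come from the lower bound \<open>c / \<epsilon>\<close> on
    \<open>s\<close> at proximity \<open>min \<epsilon> (\<delta> n) / 2\<close>; the last also uses
    that the minimum is at most \<open>\<delta> n\<close>.\<close>
  have S: "2 * c \<le> real (S n \<epsilon>) * min \<epsilon> (\<delta> n)" "1 \<le> S n \<epsilon>" "1 / \<delta> n \<le> 1 / (2 * c) * real (S n \<epsilon>)"
    if p: "(n, \<epsilon>) \<in> params" for n \<epsilon>
  proof -
    have pos: "0 < min \<epsilon> (\<delta> n)" "0 < \<delta> n"
      using p assms(7)[of n] by (auto simp: params_def)
    have "c / (min \<epsilon> (\<delta> n) / 2) \<le> real (S n \<epsilon>)"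
      unfolding S_def by (rule c(2)[OF half(1)[OF p]])
    then show le: "2 * c \<le> real (S n \<epsilon>) * min \<epsilon> (\<delta> n)"
      using pos by (simp add: field_simps)
    with c(1) have "0 < real (S n \<epsilon>) * min \<epsilon> (\<delta> n)"
      by linarith
    then have "0 < real (S n \<epsilon>)"
      using pos(1) by (rule zero_less_mult_pos2)
    then show "1 \<le> S n \<epsilon>" by simp
    have "real (S n \<epsilon>) * min \<epsilon> (\<delta> n) \<le> real (S n \<epsilon>) * \<delta> n"
      by (intro mult_left_mono) auto
    with le show "1 / \<delta> n \<le> 1 / (2 * c) * real (S n \<epsilon>)"
      using c(1) pos by (simp add: field_simps)
  qed
  obtain R\<^sub>0 :: nat where R\<^sub>0: "(8/9 :: real) ^ R\<^sub>0 < 1/10"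
    using real_arch_pow_inv[of "1/10 :: real" "8/9"] by auto
  \<comment> \<open>\<open>R\<^sub>0\<close> brings the voting error down to 1/10, and
    \<open>2 / c\<close> makes \<open>m * \<epsilon>'\<close> at least 2 * (2 / c) * (2 * c) = 8, as
    the spot checks require.\<close>
  define R where "R = max R\<^sub>0 (nat \<lceil>2 / c\<rceil>)"
  have R: "(8/9 :: real) ^ R \<le> 1/10" "2 / c \<le> real R"
  proof -
    have "(8/9 :: real) ^ R \<le> (8/9) ^ R\<^sub>0"
      by (rule power_decreasing) (auto simp: R_def)
    then show "(8/9 :: real) ^ R \<le> 1/10" using R\<^sub>0 by linarith
    show "2 / c \<le> real R" unfolding R_def by linarith
  qed
  obtain K where K: "0 \<le> K" "\<And>(S :: nat) \<delta>. 1 \<le> S \<Longrightarrow> 0 < \<delta> \<Longrightarrow> \<delta> < 1 \<Longrightarrow> 1 / \<delta> \<le> 1 / (2 * c) * real S \<Longrightarrow>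
      \<exists>k r. (8/9) ^ r \<le> (1/2 :: real) \<and>
        real (2 * R * S) * ((real k + 2) * (8/9) ^ r) + real (2 * R * S) ^ 2 * (1 - \<delta>) ^ k \<le> 1/10 \<and>
        (\<forall>b\<^sub>T b\<^sub>C. 0 \<le> b\<^sub>T \<longrightarrow> 0 \<le> b\<^sub>C \<longrightarrow> 1 \<le> b\<^sub>T + b\<^sub>C \<longrightarrow>
          real (2 * R * S) * (2 * real r * b\<^sub>T + (2 * real r * b\<^sub>C + (1 + real k * (2 * real r * b\<^sub>C))))
            \<le> K * (real S * ln (real S + 2) ^ 2) * ((b\<^sub>T + b\<^sub>C) / \<delta>))"
    by (rule tester_parameters[of "1 / (2 * c)" "2 * R"]) (use c(1) in auto)
  define m where "m n \<epsilon> = 2 * R * S n \<epsilon>" for n \<epsilon>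
  define \<sigma> where "\<sigma> n \<epsilon> = K * (real (S n \<epsilon>) * ln (real (S n \<epsilon>) + 2) ^ 2)" for n \<epsilon>
  obtain T\<^sub>D :: "nat \<Rightarrow> real \<Rightarrow> bool list list \<Rightarrow> bool pmf" where T\<^sub>D: "\<forall>(n, \<epsilon>)\<in>params. \<forall>P\<in>dists n.
        (P \<in> D n \<longrightarrow> pmf (bind_pmf (replicate_pmf (s n \<epsilon>) P) (T\<^sub>D n \<epsilon>)) True \<ge> 2/3) \<and>
        (tv_far n \<epsilon> P (D n) \<longrightarrow> pmf (bind_pmf (replicate_pmf (s n \<epsilon>) P) (T\<^sub>D n \<epsilon>)) False \<ge> 2/3)"
    using assms(3) unfolding standard_testable_def by blast
  obtain T :: "nat \<Rightarrow> real \<Rightarrow> (nat, bool) machine" where T: "\<forall>(n, \<epsilon>)\<in>params.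
        query_bounded (T n \<epsilon>) {..<n} (q\<^sub>T n \<epsilon>) \<and>
        (\<forall>x\<in>strings n.
           (x \<in> L n \<longrightarrow> pmf (machine_output (T n \<epsilon>) (\<lambda>i. x ! i)) True \<ge> 2/3) \<and>
           (far_from n \<epsilon> x (L n) \<longrightarrow> pmf (machine_output (T n \<epsilon>) (\<lambda>i. x ! i)) False \<ge> 2/3))"
    using assms(6) unfolding string_testable_def by blast
  obtain C :: "nat \<Rightarrow> nat \<Rightarrow> (nat, bool option) machine" where C: "\<forall>n\<ge>1. \<forall>i<n.
        query_bounded (C n i) {..<n} (q\<^sub>C n) \<and>
        (\<forall>x\<in>strings n.
           (x \<in> L n \<longrightarrow> pmf (machine_output (C n i) (\<lambda>j. x ! j)) (Some (x ! i)) \<ge> 2/3) \<and>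
           (\<forall>x'\<in>L n. close_to n (\<delta> n) x x' \<longrightarrow>
              measure_pmf.prob (machine_output (C n i) (\<lambda>j. x ! j)) {Some (x' ! i), None} \<ge> 2/3))"
    using assms(8) unfolding self_correctable_def by blast
  have ex: "\<exists>M. query_bounded M ({..<m n \<epsilon>} \<times> {..<n}) (\<sigma> n \<epsilon> * ((q\<^sub>T n (\<delta> n) + q\<^sub>C n) / \<delta> n)) \<and>
      (\<forall>P\<in>dists n.
        (P \<in> {P \<in> D n. set_pmf P \<subseteq> L n} \<longrightarrow> pmf (doho_output M (m n \<epsilon>) P) True \<ge> 2/3) \<and>
        (emd_far n \<epsilon> P {P \<in> D n. set_pmf P \<subseteq> L n} \<longrightarrow> pmf (doho_output M (m n \<epsilon>) P) False \<ge> 2/3))"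
    if p: "(n, \<epsilon>) \<in> params" for n \<epsilon>
  proof -
    have n: "1 \<le> n" using p by (simp add: params_def)
    have \<delta>: "0 < \<delta> n" "\<delta> n < 1" using assms(7)[OF n] by auto
    have q: "0 \<le> q\<^sub>T n (\<delta> n)" "0 \<le> q\<^sub>C n"
    proof -
      show "0 \<le> q\<^sub>T n (\<delta> n)"
        using T half(2)[OF p] by (auto intro: query_bounded_nonneg)
      have "query_bounded (C n 0) {..<n} (q\<^sub>C n)"
        using C n by simp
      then show "0 \<le> q\<^sub>C n" by (rule query_bounded_nonneg)
    qed
    show ?thesis
    proof (cases "L n = {}")
      \<comment> \<open>No distribution has support inside the empty set, so the property is empty
        and rejecting without queries is correct.\<close>
      case True
      have "0 \<le> \<sigma> n \<epsilon> * ((q\<^sub>T n (\<delta> n) + q\<^sub>C n) / \<delta> n)"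
        using K(1) q \<delta> by (simp add: \<sigma>_def)
      then have "query_bounded (mlift (return_pmf False)) ({..<m n \<epsilon>} \<times> {..<n})
          (\<sigma> n \<epsilon> * ((q\<^sub>T n (\<delta> n) + q\<^sub>C n) / \<delta> n))"
        by (rule query_bounded_mono[OF query_bounded_mlift order_refl])
      moreover have "doho_output (mlift (return_pmf False)) (m n \<epsilon>) P = return_pmf False" for P
        by (simp add: doho_output_def machine_output_mlift)
      ultimately show ?thesis
        using True by (intro exI[of _ "mlift (return_pmf False)"]) (simp add: set_pmf_not_empty)
    next
      case False
      interpret self_correcting_property n "L n" "\<delta> n" "q\<^sub>T n (\<delta> n)" "q\<^sub>C n" "T n (\<delta> n)" "C n"
      proof
        note T\<^sub>n = bspec[OF T half(2)[OF p], unfolded prod.case]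
        show "query_bounded (T n (\<delta> n)) {..<n} (q\<^sub>T n (\<delta> n))"
          using T\<^sub>n by blast
        show "2/3 \<le> pmf (machine_output (T n (\<delta> n)) ((!) x)) True" if "x \<in> L n" for x
          using that T\<^sub>n assms(5)[OF n] by blast
        show "2/3 \<le> pmf (machine_output (T n (\<delta> n)) ((!) x)) False"
          if "x \<in> strings n" "far_from n (\<delta> n) x (L n)" for x
          using that T\<^sub>n by blast
        show "2/3 \<le> pmf (machine_output (C n i) ((!) x)) (Some (x ! i))" if "i < n" "x \<in> L n" for i x
          using that C n assms(5)[OF n] by blast
      qed (use n \<delta> False C assms(5)[OF n] in auto)
      obtain T' where T':
        "\<And>P. P \<in> dists n \<Longrightarrow> P \<in> D n \<Longrightarrow>
           pmf (bind_pmf (replicate_pmf (2 * R * S n \<epsilon>) P) T') True \<ge> 1 - (8/9) ^ R"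
        "\<And>P. P \<in> dists n \<Longrightarrow> tv_far n (min \<epsilon> (\<delta> n) / 2) P (D n) \<Longrightarrow>
           pmf (bind_pmf (replicate_pmf (2 * R * S n \<epsilon>) P) T') False \<ge> 1 - (8/9) ^ R"
        "\<And>xs ys. same_pattern xs ys \<Longrightarrow> set xs \<subseteq> strings n \<Longrightarrow> set ys \<subseteq> strings n \<Longrightarrow> T' xs = T' ys"
        by (rule amplified_symmetric_tester[OF assms(2,1)[OF n], where m = "S n \<epsilon>" and r = R
              and \<epsilon> = "min \<epsilon> (\<delta> n) / 2" and T = "T\<^sub>D n (min \<epsilon> (\<delta> n) / 2)"])
           (use T\<^sub>D half(1)[OF p] in \<open>auto simp: S_def\<close>)
      obtain k r where kr: "(8/9) ^ r \<le> (1/2 :: real)"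
        "real (m n \<epsilon>) * ((real k + 2) * (8/9) ^ r) + real (m n \<epsilon>) ^ 2 * (1 - \<delta> n) ^ k \<le> 1/10"
        "\<forall>b\<^sub>T b\<^sub>C. 0 \<le> b\<^sub>T \<longrightarrow> 0 \<le> b\<^sub>C \<longrightarrow> 1 \<le> b\<^sub>T + b\<^sub>C \<longrightarrow>
          real (m n \<epsilon>) * (2 * real r * b\<^sub>T + (2 * real r * b\<^sub>C + (1 + real k * (2 * real r * b\<^sub>C))))
            \<le> \<sigma> n \<epsilon> * ((b\<^sub>T + b\<^sub>C) / \<delta> n)"
        using K(2)[OF S(2)[OF p] \<delta> S(3)[OF p]] unfolding m_def \<sigma>_def by blast
      have m8: "8 \<le> real (m n \<epsilon>) * min \<epsilon> (\<delta> n)"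
      proof -
        have "8 \<le> 2 * real R * (2 * c)"
          using R(2) c(1) by (simp add: field_simps)
        also have "\<dots> \<le> 2 * real R * (real (S n \<epsilon>) * min \<epsilon> (\<delta> n))"
          using S(1)[OF p] by (rule mult_left_mono) simp
        finally show ?thesis by (simp add: m_def mult.assoc)
      qed
      have T'9: "\<And>P. P \<in> dists n \<Longrightarrow> P \<in> D n \<Longrightarrow> pmf (bind_pmf (replicate_pmf (m n \<epsilon>) P) T') True \<ge> 9/10"
        "\<And>P. P \<in> dists n \<Longrightarrow> tv_far n (min \<epsilon> (\<delta> n) / 2) P (D n) \<Longrightarrow>
           pmf (bind_pmf (replicate_pmf (m n \<epsilon>) P) T') False \<ge> 9/10"
        using T'(1,2) R(1) unfolding m_def by fastforce+
      note tester = doho_tester[OF assms(2,1)[OF n] assms(9)[OF n] T'9 T'(3) kr(1,2) m8 min.cobounded1]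
      have "query_bounded (tester (m n \<epsilon>) k r T') ({..<m n \<epsilon>} \<times> {..<n})
          (\<sigma> n \<epsilon> * ((q\<^sub>T n (\<delta> n) + q\<^sub>C n) / \<delta> n))"
        using kr(3) q one_le_queries
        by (intro query_bounded_mono[OF query_bounded_tester order_refl]) auto
      then show ?thesis
        using tester by blast
    qed
  qed
  show ?thesis
  proof (intro exI conjI)
    show "(\<lambda>(n, \<epsilon>). real (m n \<epsilon>)) \<in> O[principal params](\<lambda>(n, \<epsilon>). real (s n (min \<epsilon> (\<delta> n) / 2)))"
      by (rule landau_o.bigI[of "2 * real R + 1"])
         (auto simp: eventually_principal m_def S_def algebra_simps)
    have "(\<lambda>(n, \<epsilon>). \<sigma> n \<epsilon>) \<in> O[principal params](\<lambda>p. (case p of (n, \<epsilon>) \<Rightarrow> real (S n \<epsilon>)) *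
        ln (\<bar>case p of (n, \<epsilon>) \<Rightarrow> real (S n \<epsilon>)\<bar> + 2) ^ 2)"
      \<comment> \<open>\<open>K\<close> is only known to be nonnegative, while the constant must be
        positive.\<close>
      by (rule landau_o.bigI[of "K + 1"])
         (use K(1) in \<open>auto simp: eventually_principal \<sigma>_def abs_mult algebra_simps\<close>)
    then show "(\<lambda>(n, \<epsilon>). \<sigma> n \<epsilon>) \<in> soft_bigo (principal params) (\<lambda>(n, \<epsilon>). real (s n (min \<epsilon> (\<delta> n) / 2)))"
      unfolding soft_bigo_def S_def by blast
    show "doho_testable (\<lambda>n. {P \<in> D n. set_pmf P \<subseteq> L n}) m
       (\<lambda>n \<epsilon>. \<sigma> n \<epsilon> * ((q\<^sub>T n (\<delta> n) + q\<^sub>C n) / \<delta> n))"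
      unfolding doho_testable_def
      \<comment> \<open>Machines may depend arbitrarily on \<open>n\<close> and \<epsilon>, so one
        is chosen separately for each pair.\<close>
      by (rule exI[of _ "\<lambda>n \<epsilon>. SOME M. query_bounded M ({..<m n \<epsilon>} \<times> {..<n}) (\<sigma> n \<epsilon> * ((q\<^sub>T n (\<delta> n) + q\<^sub>C n) / \<delta> n)) \<and>
      (\<forall>P\<in>dists n.
        (P \<in> {P \<in> D n. set_pmf P \<subseteq> L n} \<longrightarrow> pmf (doho_output M (m n \<epsilon>) P) True \<ge> 2/3) \<and>
        (emd_far n \<epsilon> P {P \<in> D n. set_pmf P \<subseteq> L n} \<longrightarrow> pmf (doho_output M (m n \<epsilon>) P) False \<ge> 2/3))"])
        (clarify, rule someI_ex, rule ex)
  qed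
qed

end
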